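(* Let $n$ be a non-negative integer and let $$\Theta_2(n,0)=\sum_{k=1}^\infty (-1)^k\frac{\psi\left(\frac{2k+2n+5}{4}\right)-\psi\left(\frac{2k+2n+3}{4}\right)}{(2k)^2}.$$ Then: (i) if $n=0$: $\Theta_2(0,0)=-4+\pi+2\ln 2-\frac{\pi}{4}\ln^2 2-\frac{\pi^2}{12}-\frac{5\pi^3}{48}-2G\ln 2+4\,\Im(\mathrm{Li}_3(1+i))$; (ii) if $n=1$: $\Theta_2(1,0)=\frac{116}{27}-\frac{10\pi}{9}-\frac{16\ln 2}{9}+\frac{\pi}{4}\ln^2 2+\frac{\pi^2}{18}+\frac{5\pi^3}{48}+2G\ln 2-4\,\Im(\mathrm{Li}_3(1+i))$; (iii) if $n$ is odd and $n\neq1$: $$\begin{aligned}\Theta_2(n,0)={}&\frac{116}{27}+8\sum_{k=1}^{\frac{n-1}{2}}\sum_{j=0}^{2k}\frac{(-1)^j(16k^2+16k+5)}{(2j+1)(4k+3)^2(4k+1)^2}-4\sum_{j=1}^{\frac{n-1}{2}}\frac{1}{(4j+3)^3}\\&+\left(-\frac{10}{9}-\sum_{j=1}^{\frac{n-1}{2}}\frac{2(16j^2+16j+5)}{(4j+3)^2(4j+1)^2}+\frac14\ln^2 2\right)\pi-\left(\frac19+\sum_{j=1}^{\frac{n-1}{2}}\frac{2j+1}{(4j+3)^2(4j+1)^2}\right)16\ln 2\\&+\left(\frac1{18}+\frac16\sum_{j=1}^{\frac{n-1}{2}}\frac{1}{(4j+3)(4j+1)}\right)\pi^2+\frac{5\pi^3}{48}+2G\ln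 2-4\,\Im(\mathrm{Li}_3(1+i));\end{aligned}$$ (iv) if $n$ is even: $$\begin{aligned}\Theta_2(n,0)={}&-4-8\sum_{k=0}^{\frac{n-2}{2}}\sum_{j=0}^{2k+1}\frac{(-1)^j(16k^2+32k+17)}{(2j+1)(4k+5)^2(4k+3)^2}-4\sum_{j=0}^{\frac{n-2}{2}}\frac{1}{(4j+5)^3}\\&+\left(1+\sum_{j=0}^{\frac{n-2}{2}}\frac{2(16j^2+32j+17)}{(4j+5)^2(4j+3)^2}-\frac14\ln^2 2\right)\pi+\left(1-16\sum_{j=0}^{\frac{n-2}{2}}\frac{j+1}{(4j+5)^2(4j+3)^2}\right)2\ln 2\\&+\left(-\frac12+\sum_{j=0}^{\frac{n-2}{2}}\frac{1}{(4j+5)(4j+3)}\right)\frac{\pi^2}{6}-\frac{5\pi^3}{48}-2G\ln 2+4\,\Im(\mathrm{Li}_3(1+i)).\end{aligned}$$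
   Context: $\psi=\Gamma'/\Gamma$ is the digamma function, $G=\sum_{k=0}^\infty\frac{(-1)^k}{(2k+1)^2}$ is Catalan's constant, and $\mathrm{Li}_3$ is the trilogarithm, $\mathrm{Li}_3(z)=\sum_{k\ge1}z^k/k^3$ for $|z|\le1$, analytically continued to $\mathbb C\setminus[1,\infty)$ (principal branch); $\Im(\mathrm{Li}_3(1+i))\approx1.2670834419$. Empty sums (such as $\sum_{j=0}^{-1}$) are $0$. *)

theory Defs
  imports "HOL-Complex_Analysis.Complex_Analysis"
begin

definition catalan_const :: real where
  "catalan_const = (\<Sum>k. (- 1) ^ k / (2 * real k + 1) ^ 2)"

definition slit_plane :: "complex set" where
  "slit_plane = - (of_real ` {1..})"

definition Li3_series :: "complex \<Rightarrow> complex" where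
  "Li3_series z = (\<Sum>k. z ^ Suc k / of_nat (Suc k) ^ 3)"

text \<open>
  Outside the closed unit disc, the trilogarithm is the value of any holomorphic function on the
  slit plane that extends the power series. Existence and uniqueness of that extension are
  shown below; on the cut beyond 1 the value is unspecified.
\<close>
definition Li3 :: "complex \<Rightarrow> complex" where
  "Li3 z = (if norm z \<le> 1 then Li3_series z
            else (THE w. \<exists>f. f holomorphic_on slit_plane
                           \<and> (\<forall>u\<in>ball 0 1. f u = Li3_series u) \<and> w = f z))"

definition Theta2_0_term :: "nat \<Rightarrow> nat \<Rightarrow> real" where
  "Theta2_0_term n k =
     (- 1) ^ k * (Digamma ((2 * real k + 2 * real n + 5) / 4)
                  - Digamma ((2 * real k + 2 * real n + 3) / 4)) / (2 * real k) ^ 2"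

text \<open>The sum starts at index 1, hence the shift.\<close>
definition Theta2_0 :: "nat \<Rightarrow> real" where
  "Theta2_0 n = (\<Sum>k. Theta2_0_term n (Suc k))"


subsection \<open>Well-definedness of the trilogarithm\<close>

lemma open_slit_plane: "open slit_plane"
proof -
  have "of_real ` {1..} = {z::complex. Im z = 0 \<and> 1 \<le> Re z}"
    by (auto simp: complex_eq_iff intro!: image_eqI[where x = "Re _"])
  moreover have "closed {z::complex. Im z = 0 \<and> 1 \<le> Re z}"
    by (intro closed_Collect_conj closed_Collect_eq closed_Collect_le continuous_intros)
  ultimately show ?thesis
    by (simp add: slit_plane_def open_Compl)
qed

lemma in_slit_plane_iff: "z \<in> slit_plane \<longleftrightarrow> Im z \<noteq> 0 \<or> Re z < 1"
  by (force simp: slit_plane_def complex_eq_iff image_iff not_le)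

lemma zero_in_slit_plane: "0 \<in> slit_plane"
  by (simp add: in_slit_plane_iff)

lemma starlike_slit_plane: "starlike slit_plane"
  unfolding starlike_def
proof (intro bexI[OF _ zero_in_slit_plane] ballI subsetI)
  fix x y :: complex
  assume x: "x \<in> slit_plane" and "y \<in> closed_segment 0 x"
  then obtain t where t: "0 \<le> t" "t \<le> 1" "y = t *\<^sub>R x"
    by (auto simp: in_segment)
  have "t * Re x < 1" if "Re x < 1"
  proof (cases "Re x \<le> 0")
    case True
    with t(1) have "t * Re x \<le> 0" by (simp add: mult_nonneg_nonpos)
    then show ?thesis by simp
  next
    case False
    with t have "t * Re x \<le> 1 * Re x" by (intro mult_right_mono) auto
    with that show ?thesis by simp
  qed
  with x t show "y \<in> slit_plane"
    by (cases "t = 0") (auto simp: in_slit_plane_iff)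
qed

lemma unit_ball_subset_slit_plane: "ball 0 1 \<subseteq> slit_plane"
proof
  fix z :: complex assume "z \<in> ball 0 1"
  then show "z \<in> slit_plane"
    using complex_Re_le_cmod[of z] by (simp add: in_slit_plane_iff)
qed

lemma polylog_continuation_exists:
  "\<exists>f. f holomorphic_on slit_plane
     \<and> (\<forall>u\<in>ball 0 1. (\<lambda>k. u ^ Suc k / of_nat (Suc k) ^ s) sums f u)"
proof (induction s)
  case 0
  have "(\<lambda>z. z / (1 - z)) holomorphic_on slit_plane"
    by (intro holomorphic_intros) (auto simp: in_slit_plane_iff)
  moreover have "(\<lambda>k. u ^ Suc k / of_nat (Suc k) ^ 0) sums (u / (1 - u))" if "u \<in> ball 0 1" for u :: complex
    using sums_mult[OF geometric_sums[of u], of u] that by simp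
  ultimately show ?case by blast
next
  case (Suc s)
  then obtain g where g: "g holomorphic_on slit_plane"
    and gs: "\<And>u. u \<in> ball 0 1 \<Longrightarrow> (\<lambda>k. u ^ Suc k / of_nat (Suc k) ^ s) sums g u"
    by blast
  have g0: "g 0 = 0"
    using sums_unique[OF gs[of 0]] by simp
  define q where "q z = (if z = 0 then deriv g 0 else g z / z)" for z
  have hq: "q holomorphic_on slit_plane"
    by (rule pole_theorem_open_0[OF g open_slit_plane, of 0]) (auto simp: q_def g0)
  have "\<exists>h. \<forall>z\<in>slit_plane. (h has_field_derivative q z) (at z)"
    by (rule holomorphic_starlike_primitive[OF holomorphic_on_imp_continuous_on[OF hq]
          starlike_slit_plane open_slit_plane finite.emptyI])
       (use hq open_slit_plane holomorphic_on_imp_differentiable_at in auto)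
  then obtain h where h: "\<And>z. z \<in> slit_plane \<Longrightarrow> (h has_field_derivative q z) (at z)"
    by blast
  define a b where "a n = 1 / (of_nat (Suc n) ^ s :: complex)"
    and "b n = (if n = 0 then 0 else 1 / (of_nat n ^ Suc s :: complex))" for n
  have diffs: "diffs b = a"
    by (auto simp: diffs_def a_def b_def fun_eq_iff simp del: of_nat_Suc)
  have summ_a: "summable (\<lambda>n. a n * u ^ n)" if "norm u < 1" for u
  proof (rule summable_comparison_test'[where N = 0])
    show "summable (\<lambda>n. norm u ^ n)"
      using that by (simp add: summable_geometric)
    show "norm (a n * u ^ n) \<le> norm u ^ n" for n
    proof -
      have "1 \<le> real (Suc n) ^ s" by (rule one_le_power) simp
      then have "norm (a n) \<le> 1"
        by (simp add: a_def norm_divide norm_power del: of_nat_Suc)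
      then show ?thesis
        by (simp add: norm_mult norm_power mult_left_le_one_le)
    qed
  qed
  have summ_b: "summable (\<lambda>n. b n * u ^ n)" if "norm u < 1" for u
  proof (rule summable_comparison_test'[where N = 0])
    show "summable (\<lambda>n. norm u ^ n)"
      using that by (simp add: summable_geometric)
    show "norm (b n * u ^ n) \<le> norm u ^ n" for n
    proof -
      have "n \<noteq> 0 \<Longrightarrow> 1 \<le> real n ^ Suc s" by (rule one_le_power) simp
      then have "norm (b n) \<le> 1"
        by (simp add: b_def norm_divide norm_power norm_mult)
      then show ?thesis
        by (simp add: norm_mult norm_power mult_left_le_one_le)
    qed
  qed
  have deriv_b: "((\<lambda>u. \<Sum>n. b n * u ^ n) has_field_derivative (\<Sum>n. a n * u ^ n)) (at u)"
    if "norm u < 1" for u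
    using termdiffs_strong'[of 1 b u] summ_b that by (simp add: diffs)
  have shift: "g u = u * (\<Sum>n. a n * u ^ n)" if "norm u < 1" for u
  proof -
    have "(\<lambda>n. u * (a n * u ^ n)) sums (u * (\<Sum>n. a n * u ^ n))"
      by (intro sums_mult summable_sums summ_a that)
    moreover have "(\<lambda>n. u * (a n * u ^ n)) sums g u"
      using gs[of u] that by (simp add: a_def mult_ac)
    ultimately show ?thesis by (rule sums_unique2[symmetric])
  qed
  have q_eq: "q u = (\<Sum>n. a n * u ^ n)" if "u \<in> ball 0 1" for u
  proof -
    have cont: "continuous_on (ball 0 1) (\<lambda>u. \<Sum>n. a n * u ^ n)"
    proof -
      have "isCont (\<lambda>u. \<Sum>n. a n * u ^ n) u" if "norm u < 1" for u
        using termdiffs_strong'[of 1 a u] summ_a that by (auto intro: DERIV_isCont)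
      then show ?thesis by (intro continuous_at_imp_continuous_on) auto
    qed
    have "((\<lambda>u. \<Sum>n. a n * u ^ n) \<longlongrightarrow> (\<Sum>n. a n * 0 ^ n)) (at 0)"
      using cont by (simp add: continuous_on_eq_continuous_at isCont_def del: powser_zero)
    moreover have "\<forall>\<^sub>F u in at 0. (\<Sum>n. a n * u ^ n) = q u"
      unfolding eventually_at by (intro exI[of _ 1]) (auto simp: q_def shift)
    ultimately have "(q \<longlongrightarrow> (\<Sum>n. a n * 0 ^ n)) (at 0)"
      by (rule Lim_transform_eventually)
    moreover have "(q \<longlongrightarrow> q 0) (at 0)"
      using holomorphic_on_imp_continuous_on[OF hq] open_slit_plane zero_in_slit_plane
      by (auto simp: continuous_on_eq_continuous_at isCont_def)
    ultimately have "q 0 = (\<Sum>n. a n * 0 ^ n)"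
      using LIM_unique by blast
    with that show ?thesis
      by (cases "u = 0") (auto simp: q_def shift)
  qed
  have "\<exists>c. \<forall>u\<in>ball 0 1. h u - (\<Sum>n. b n * u ^ n) = c"
  proof (rule has_field_derivative_zero_constant[OF convex_ball])
    fix u :: complex assume u: "u \<in> ball 0 1"
    have "((\<lambda>u. h u - (\<Sum>n. b n * u ^ n)) has_field_derivative q u - (\<Sum>n. a n * u ^ n)) (at u)"
      using u unit_ball_subset_slit_plane by (intro DERIV_diff h deriv_b) auto
    then show "((\<lambda>u. h u - (\<Sum>n. b n * u ^ n)) has_field_derivative 0) (at u within ball 0 1)"
      using q_eq[OF u] by (simp add: has_field_derivative_at_within)
  qed
  then obtain c where c: "\<And>u. u \<in> ball 0 1 \<Longrightarrow> h u - (\<Sum>n. b n * u ^ n) = c"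
    by blast
  have "(\<lambda>z. h z - c) holomorphic_on slit_plane"
    using h open_slit_plane
    by (intro holomorphic_intros) (auto simp: holomorphic_on_open)
  moreover have "(\<lambda>k. u ^ Suc k / of_nat (Suc k) ^ Suc s) sums (h u - c)" if "u \<in> ball 0 1" for u
  proof -
    have "(\<lambda>n. b n * u ^ n) sums (h u - c)"
      using summable_sums[OF summ_b[of u]] c[OF that] that by (simp add: algebra_simps)
    then have "(\<lambda>n. b (Suc n) * u ^ Suc n) sums (h u - c)"
      by (subst sums_Suc_iff) (simp add: b_def)
    then show ?thesis by (simp add: b_def del: of_nat_Suc)
  qed
  ultimately show ?case by blast
qed

lemma summable_Li3_bound: "summable (\<lambda>k. 1 / real (Suc k) ^ 3)"
proof -
  have "summable (\<lambda>k. inverse (real k ^ 3))"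
    by (rule inverse_power_summable) simp
  then show ?thesis
    by (subst (asm) summable_Suc_iff[symmetric]) (simp only: inverse_eq_divide)
qed

lemma Li3_series_continuous: "continuous_on (cball 0 1) Li3_series"
proof -
  have "uniform_limit (cball 0 1) (\<lambda>n z. \<Sum>k<n. z ^ Suc k / of_nat (Suc k) ^ 3)
          (\<lambda>z. \<Sum>k. z ^ Suc k / (of_nat (Suc k) ^ 3 :: complex)) sequentially"
  proof (rule Weierstrass_m_test[OF _ summable_Li3_bound])
    fix k and z :: complex assume "z \<in> cball 0 1"
    then have "norm z ^ Suc k \<le> 1" by (intro power_le_one) auto
    then show "norm (z ^ Suc k / of_nat (Suc k) ^ 3) \<le> 1 / real (Suc k) ^ 3"
      by (simp add: norm_divide norm_power divide_right_mono del: of_nat_Suc power_Suc)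
  qed
  then have "continuous_on (cball 0 1) (\<lambda>z. \<Sum>k. z ^ Suc k / (of_nat (Suc k) ^ 3 :: complex))"
    by (rule uniform_limit_theorem[rotated])
       (auto intro!: always_eventually continuous_intros simp del: of_nat_Suc)
  then show ?thesis by (simp add: Li3_series_def[abs_def])
qed

text \<open>On the slit plane, any such extension coincides with the trilogarithm.\<close>
lemma Li3_unique:
  assumes f: "f holomorphic_on slit_plane" and fu: "\<And>u. u \<in> ball 0 1 \<Longrightarrow> f u = Li3_series u"
    and z: "z \<in> slit_plane"
  shows "Li3 z = f z"
proof (cases "norm z \<le> 1")
  case True
  let ?S = "cball 0 1 \<inter> slit_plane"
  have "((\<lambda>w. f w - Li3_series w) \<longlongrightarrow> f z - Li3_series z) (at z within ball 0 1)"
  proof (rule tendsto_within_subset)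
    have "continuous_on ?S (\<lambda>w. f w - Li3_series w)"
      by (intro continuous_intros continuous_on_subset[OF Li3_series_continuous]
            continuous_on_subset[OF holomorphic_on_imp_continuous_on[OF f]]) auto
    with z True show "((\<lambda>w. f w - Li3_series w) \<longlongrightarrow> f z - Li3_series z) (at z within ?S)"
      by (auto simp: continuous_on_def)
    show "ball 0 1 \<subseteq> ?S" using unit_ball_subset_slit_plane by auto
  qed
  moreover have "\<forall>\<^sub>F w in at z within ball 0 1. f w - Li3_series w = 0"
    by (auto simp: eventually_at_filter fu)
  ultimately have "((\<lambda>_. 0) \<longlongrightarrow> f z - Li3_series z) (at z within ball 0 1)"
    by (rule Lim_transform_eventually)
  moreover have "z islimpt ball 0 1"
    using True by (simp add: islimpt_ball)
  ultimately have "f z - Li3_series z = 0"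
    by (metis tendsto_const_iff trivial_limit_within)
  with True show ?thesis by (simp add: Li3_def)
next
  case False
  have "w = f z" if "g holomorphic_on slit_plane" "\<forall>u\<in>ball 0 1. g u = Li3_series u" "w = g z" for g w
    using analytic_continuation_open[of "ball 0 1" slit_plane g f z]
      that f fu z open_slit_plane unit_ball_subset_slit_plane
      starlike_imp_connected[OF starlike_slit_plane]
    by auto
  then have "(THE w. \<exists>g. g holomorphic_on slit_plane
      \<and> (\<forall>u\<in>ball 0 1. g u = Li3_series u) \<and> w = g z) = f z"
    using f fu by (intro the_equality) blast+
  with False show ?thesis by (simp add: Li3_def)
qed

lemma Li3_holomorphic: "Li3 holomorphic_on slit_plane"
proof -
  obtain f where f: "f holomorphic_on slit_plane"
    and "\<forall>u\<in>ball 0 1. (\<lambda>k. u ^ Suc k / of_nat (Suc k) ^ 3) sums f u"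
    using polylog_continuation_exists[of 3] by blast
  then have "f u = Li3_series u" if "u \<in> ball 0 1" for u
    using that sums_unique unfolding Li3_series_def by blast
  then show ?thesis
    using holomorphic_transform[OF f] Li3_unique[OF f] by metis
qed

end

theory Submission
  imports Defs "HOL-Real_Asymp.Real_Asymp"
begin

text \<open>
  Write \<open>I k\<close> for the integral of \<open>x\<^sup>2\<^sup>k / (1 + x\<^sup>2)\<close> over \<open>[0,1]\<close>. The Digamma recurrence
  and the value of \<open>\<psi>(3/4) - \<psi>(1/4)\<close> turn the series into
  \<open>T (n + 1)\<close>, where \<open>T n\<close> is the sum of \<open>(-1)\<^sup>k I (k + n) / k\<^sup>2\<close> over \<open>k \<ge> 1\<close>. Since
  \<open>I k + I (k + 1) = 1 / (2 k + 1)\<close>, the sum \<open>T n + T (n + 1)\<close> is elementary by partial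
  fractions, so everything reduces to \<open>T 0\<close>, the integral of \<open>Li\<^sub>2(-x\<^sup>2) / (1 + x\<^sup>2)\<close>.
  Integrating by parts leaves the imaginary part of the integral of \<open>ln\<^sup>2(1 - w) / w\<close> from 0 to
  \<open>-\<i>\<close>, which has the primitive
  \<open>ln w ln\<^sup>2(1 - w) + 2 ln(1 - w) Li\<^sub>2(1 - w) - 2 Li\<^sub>3(1 - w)\<close>, and \<open>Li\<^sub>2(1 + \<i>)\<close> follows from the
  reflection formula for the dilogarithm.
\<close>

subsection \<open>Reduction to a single series\<close>

definition atan_moment :: "nat \<Rightarrow> real" where
  "atan_moment k = integral {0..1} (\<lambda>x. x ^ (2 * k) / (1 + x\<^sup>2))"

lemma one_plus_square_pos: "0 < 1 + (x::real)\<^sup>2"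
  by (simp add: add_pos_nonneg)

lemma one_plus_square_ne: "1 + (x::real)\<^sup>2 \<noteq> 0"
  using one_plus_square_pos[of x] by simp

lemma atan_moment_has_integral:
  "((\<lambda>x. x ^ (2 * k) / (1 + x\<^sup>2)) has_integral atan_moment k) {0..1}"
  unfolding atan_moment_def
  by (intro integrable_integral integrable_continuous_real continuous_intros) (simp add: one_plus_square_ne)

lemma atan_moment_0: "atan_moment 0 = pi / 4"
proof -
  have "((\<lambda>x. 1 / (1 + x\<^sup>2)) has_integral (arctan 1 - arctan 0)) {0..1}"
    by (intro fundamental_theorem_of_calculus)
       (auto simp: has_real_derivative_iff_has_vector_derivative[symmetric] one_plus_square_ne
          intro!: derivative_eq_intros simp: inverse_eq_divide)
  then show ?thesis
    using has_integral_unique[OF atan_moment_has_integral[of 0]] by (simp add: arctan_one)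
qed

text \<open>The factor \<open>1 + x\<^sup>2\<close> cancels when the two integrands are added, which
  leaves \<open>x ^ (2 * k)\<close>.\<close>

lemma atan_moment_Suc: "atan_moment k + atan_moment (Suc k) = 1 / (2 * real k + 1)"
proof -
  have "((\<lambda>x. x ^ (2 * k) / (1 + x\<^sup>2) + x ^ (2 * Suc k) / (1 + x\<^sup>2)) has_integral
      atan_moment k + atan_moment (Suc k)) {0..1}"
    by (intro has_integral_add atan_moment_has_integral)
  moreover have "x ^ (2 * k) / (1 + x\<^sup>2) + x ^ (2 * Suc k) / (1 + x\<^sup>2) = x ^ (2 * k)" for x :: real
    using one_plus_square_ne[of x] by (simp add: divide_simps) (simp add: algebra_simps power2_eq_square)
  ultimately have "((\<lambda>x::real. x ^ (2 * k)) has_integral atan_moment k + atan_moment (Suc k)) {0..1}"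
    by simp
  moreover have "((\<lambda>x::real. x ^ (2 * k)) has_integral
      (1 ^ Suc (2 * k) / real (Suc (2 * k)) - 0 ^ Suc (2 * k) / real (Suc (2 * k)))) {0..1}"
  proof (rule fundamental_theorem_of_calculus)
    fix x :: real
    have "((\<lambda>x. x ^ Suc (2 * k) / real (Suc (2 * k))) has_real_derivative x ^ (2 * k)) (at x within {0..1})"
      by (rule derivative_eq_intros refl)+ (simp_all del: of_nat_Suc)
    then show "((\<lambda>x. x ^ Suc (2 * k) / real (Suc (2 * k))) has_vector_derivative x ^ (2 * k)) (at x within {0..1})"
      by (simp only: has_real_derivative_iff_has_vector_derivative)
  qed simp
  ultimately show ?thesis
    by (auto dest: has_integral_unique)
qed

text \<open>The upper bound comes from the recurrence, whose other moment is nonnegative. These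
  bounds give absolute convergence of the moment series.\<close>

lemma atan_moment_bounds: "0 \<le> atan_moment k" "atan_moment k \<le> 1"
proof -
  have nonneg: "0 \<le> atan_moment k" for k
    by (rule has_integral_nonneg[OF atan_moment_has_integral]) simp
  show "0 \<le> atan_moment k" by (fact nonneg)
  have "1 / (2 * real k + 1) \<le> 1" by simp
  then show "atan_moment k \<le> 1"
    using atan_moment_Suc[of k] nonneg[of "Suc k"] by linarith
qed

section \<open>Digamma differences as moments\<close>

lemma leibniz_sums: "(\<lambda>k. (- 1) ^ k / (2 * real k + 1)) sums (pi / 4)"
proof -
  have "summable (\<lambda>k. (- 1) ^ k / (2 * real k + 1))"
    using summable_arctan_series[of 1] by (simp add: ac_simps)
  then show ?thesis
    using pi_series by (simp add: sums_iff ac_simps)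
qed

text \<open>In the limit formula for \<open>Digamma\<close> the logarithms cancel, and
  \<open>1 / (n + 1/4) - 1 / (n + 3/4)\<close> is four times a pair of consecutive terms of the
  Leibniz series.\<close>

lemma Digamma_three_quarters_diff: "Digamma (3 / 4 :: real) - Digamma (1 / 4) = pi"
proof -
  let ?f = "\<lambda>k. (- 1) ^ k / (2 * real k + 1)"
  have "(\<lambda>m. (ln (real m) - (\<Sum>n<m. inverse (3 / 4 + real n)))
         - (ln (real m) - (\<Sum>n<m. inverse (1 / 4 + real n)))) \<longlonglongrightarrow> Digamma (3 / 4) - Digamma (1 / 4)"
    using Digamma_LIMSEQ[of "3 / 4 :: real"] Digamma_LIMSEQ[of "1 / 4 :: real"]
    by (intro tendsto_diff) simp_all
  moreover have "(ln (real m) - (\<Sum>n<m. inverse (3 / 4 + real n)))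
         - (ln (real m) - (\<Sum>n<m. inverse (1 / 4 + real n))) = (\<Sum>n<m. 4 * sum ?f {n * 2..<n * 2 + 2})" for m
  proof -
    have "4 * sum ?f {n * 2..<n * 2 + 2} = inverse (1 / 4 + real n) - inverse (3 / 4 + real n)" for n
    proof -
      have "{n * 2..<n * 2 + 2} = {n * 2, Suc (n * 2)}" by auto
      then show ?thesis by (simp add: divide_simps) (simp add: algebra_simps)
    qed
    then show ?thesis by (simp add: sum_subtractf)
  qed
  ultimately have "(\<lambda>n. 4 * sum ?f {n * 2..<n * 2 + 2}) sums (Digamma (3 / 4) - Digamma (1 / 4))"
    by (simp add: sums_def)
  moreover have "(\<lambda>n. 4 * sum ?f {n * 2..<n * 2 + 2}) sums (4 * (pi / 4))"
    by (intro sums_mult sums_group leibniz_sums) simp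
  ultimately show ?thesis
    using sums_unique2 by fastforce
qed

text \<open>Both sides obey the same recurrence. The lower argument for \<open>Suc k\<close> is the
  upper one for \<open>k\<close>, and the upper argument for \<open>Suc k\<close> exceeds the lower
  one for \<open>k\<close> by 1, where \<open>Digamma_plus1\<close> applies.\<close>

lemma Digamma_diff_eq_atan_moment:
  "Digamma ((2 * real k + 3) / 4) - Digamma ((2 * real k + 1) / 4) = 4 * atan_moment k"
proof (induction k)
  case 0
  then show ?case by (simp add: atan_moment_0 Digamma_three_quarters_diff)
next
  case (Suc k)
  have "Digamma ((2 * real (Suc k) + 3) / 4) = Digamma ((2 * real k + 1) / 4 + 1)"
    by (simp add: field_simps)
  also have "\<dots> = Digamma ((2 * real k + 1) / 4) + 4 / (2 * real k + 1)"
    by (subst Digamma_plus1) auto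
  finally have "Digamma ((2 * real (Suc k) + 3) / 4) = \<dots>" .
  moreover have "Digamma ((2 * real (Suc k) + 1) / 4) = Digamma ((2 * real k + 3) / 4)"
    by (rule arg_cong[of _ _ Digamma]) simp
  moreover have "4 * atan_moment k + 4 * atan_moment (Suc k) = 4 / (2 * real k + 1)"
    using arg_cong[OF atan_moment_Suc[of k], of "\<lambda>x. 4 * x"] by simp
  ultimately show ?case
    using Suc.IH by linarith
qed

section \<open>The moment series and its recurrence\<close>

lemma summable_inverse_Suc_squares: "summable (\<lambda>k. 1 / (real (Suc k))\<^sup>2)"
  using inverse_squares_sums by (simp add: sums_iff add.commute)

text \<open>The sum \<open>T n\<close> of the overview is
  \<open>suminf (moment_term n)\<close>.\<close>

definition moment_term :: "nat \<Rightarrow> nat \<Rightarrow> real" where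
  "moment_term n k = (- 1) ^ Suc k * atan_moment (Suc k + n) / (real (Suc k))\<^sup>2"

lemma summable_moment_term: "summable (moment_term n)"
proof (rule summable_comparison_test'[OF summable_inverse_Suc_squares])
  show "norm (moment_term n k) \<le> 1 / (real (Suc k))\<^sup>2" for k
    using atan_moment_bounds[of "Suc k + n"]
    by (auto simp: moment_term_def abs_mult intro!: divide_right_mono)
qed

text \<open>With \<open>Suc k + Suc n\<close> as the moment index the Digamma arguments match, and
  the resulting factor 4 cancels against the square of 2 in the denominator.\<close>

lemma Theta2_0_term_eq: "Theta2_0_term n (Suc k) = moment_term (Suc n) k"
proof -
  have "2 * real (Suc k) + 2 * real n + 5 = 2 * real (Suc k + Suc n) + 3"
    "2 * real (Suc k) + 2 * real n + 3 = 2 * real (Suc k + Suc n) + 1" by simp_all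
  then have "Theta2_0_term n (Suc k) = (- 1) ^ Suc k * (4 * atan_moment (Suc k + Suc n)) / (2 * real (Suc k))\<^sup>2"
    unfolding Theta2_0_term_def by (simp only: Digamma_diff_eq_atan_moment)
  then show ?thesis
    by (simp add: moment_term_def power_mult_distrib del: of_nat_Suc)
qed

text \<open>Reversing the sign of the terms with even base subtracts them twice from the series of
  inverse squares, and together they make up a quarter of that series.\<close>

lemma alternating_squares_sums: "(\<lambda>n. (- 1) ^ n / (real (Suc n))\<^sup>2) sums (pi\<^sup>2 / 12)"
proof -
  let ?f = "\<lambda>n. 1 / (real (Suc n))\<^sup>2" and ?g = "\<lambda>n. (- 1) ^ n / (real (Suc n))\<^sup>2"
  \<comment> \<open>Convergence is secured first: the paired series alone only controls every second
    partial sum.\<close>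
  have "summable ?g"
    by (rule summable_comparison_test'[OF summable_inverse_Suc_squares]) simp
  then obtain s where s: "?g sums s" by (auto simp: summable_def)
  have f: "?f sums (pi\<^sup>2 / 6)"
    using inverse_squares_sums by (simp add: add.commute)
  have eq: "sum ?f {n * 2..<n * 2 + 2} - 2 * (1 / 4 * ?f n) = sum ?g {n * 2..<n * 2 + 2}" for n
  proof -
    have "{n * 2..<n * 2 + 2} = {n * 2, Suc (n * 2)}" by auto
    moreover have "1 / (real (Suc (Suc (n * 2))))\<^sup>2 = 1 / 4 * ?f n"
    proof -
      have "real (Suc (Suc (n * 2))) = 2 * real (Suc n)" by simp
      then show ?thesis by (simp only: power_mult_distrib) simp
    qed
    ultimately show ?thesis by (simp del: of_nat_Suc)
  qed
  have "(\<lambda>n. sum ?f {n * 2..<n * 2 + 2} - 2 * (1 / 4 * ?f n)) sums (pi\<^sup>2 / 6 - 2 * (1 / 4 * (pi\<^sup>2 / 6)))"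
    by (intro sums_diff sums_mult sums_group f) simp
  moreover have "pi\<^sup>2 / 6 - 2 * (1 / 4 * (pi\<^sup>2 / 6)) = pi\<^sup>2 / 12" by simp
  ultimately have "(\<lambda>n. sum ?g {n * 2..<n * 2 + 2}) sums (pi\<^sup>2 / 12)"
    unfolding eq by metis
  moreover have "(\<lambda>n. sum ?g {n * 2..<n * 2 + 2}) sums s"
    by (intro sums_group s) simp
  ultimately have "pi\<^sup>2 / 12 = s"
    by (rule sums_unique2)
  with s show ?thesis by (simp only:)
qed

text \<open>This is a tail of the Leibniz series, multiplied by \<open>(- 1) ^ n\<close> so that the
  first sign is always negative.\<close>

lemma leibniz_tail_sums:
  "(\<lambda>k. (- 1) ^ Suc k / (2 * real (Suc k + n) + 1)) sums
     ((- 1) ^ n * (pi / 4 - (\<Sum>j\<le>n. (- 1) ^ j / (2 * real j + 1))))"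
proof -
  let ?f = "\<lambda>k. (- 1) ^ k / (2 * real k + 1)"
  have "(\<lambda>k. ?f (k + Suc n)) sums (pi / 4 - (\<Sum>j<Suc n. ?f j))"
    by (rule sums_split_initial_segment[OF leibniz_sums])
  then have "(\<lambda>k. (- 1) ^ n * ?f (k + Suc n)) sums ((- 1) ^ n * (pi / 4 - (\<Sum>j\<le>n. ?f j)))"
    unfolding lessThan_Suc_atMost by (rule sums_mult)
  moreover have "(- 1) ^ n * ?f (k + Suc n) = (- 1) ^ Suc k / (2 * real (Suc k + n) + 1)" for k
    by (simp add: power_add algebra_simps flip: power_mult_distrib)
  ultimately show ?thesis by simp
qed

lemma partial_fractions_square:
  fixes a x :: real
  assumes "a \<noteq> 0" "x \<noteq> 0" "2 * x + a \<noteq> 0"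
  shows "1 / (x\<^sup>2 * (2 * x + a)) = 1 / a * (1 / x\<^sup>2) - 2 / a\<^sup>2 * (1 / x) + 4 / a\<^sup>2 * (1 / (2 * x + a))"
  using assms by (simp add: divide_simps) (simp add: algebra_simps power2_eq_square)

text \<open>By the moment recurrence the two summands add up to
  \<open>(- 1) ^ Suc k / (x\<^sup>2 * (2 * x + a))\<close> with \<open>x = Suc k\<close> and
  \<open>a = 2 * n + 1\<close>. Its partial fractions are multiples of the terms of the alternating
  series for \<open>pi\<^sup>2 / 12\<close> and \<open>ln 2\<close> and of a Leibniz tail.\<close>

lemma suminf_moment_term_Suc:
  "suminf (moment_term n) + suminf (moment_term (Suc n)) =
     - pi\<^sup>2 / (12 * (2 * real n + 1)) + 2 * ln 2 / (2 * real n + 1)\<^sup>2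
     + 4 * (- 1) ^ n * (pi / 4 - (\<Sum>j\<le>n. (- 1) ^ j / (2 * real j + 1))) / (2 * real n + 1)\<^sup>2"
proof -
  define a where "a = 2 * real n + 1"
  define t where "t = (- 1) ^ n * (pi / 4 - (\<Sum>j\<le>n. (- 1) ^ j / (2 * real j + 1)))"
  have a: "a > 0" by (simp add: a_def)
  have "(\<lambda>k. moment_term n k + moment_term (Suc n) k) sums
      (suminf (moment_term n) + suminf (moment_term (Suc n)))"
    by (intro sums_add summable_sums summable_moment_term)
  moreover have "moment_term n k + moment_term (Suc n) k =
      - (1 / a) * ((- 1) ^ k / (real (Suc k))\<^sup>2) + 2 / a\<^sup>2 * ((- 1) ^ k / real (Suc k))
      + 4 / a\<^sup>2 * ((- 1) ^ Suc k / (2 * real (Suc k + n) + 1))" for k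
  proof -
    let ?x = "real (Suc k)"
    have "moment_term n k + moment_term (Suc n) k =
        (- 1) ^ Suc k * (atan_moment (Suc k + n) + atan_moment (Suc (Suc k + n))) / ?x\<^sup>2"
      by (simp add: moment_term_def add_divide_distrib distrib_left del: of_nat_Suc power_Suc)
    also have "\<dots> = (- 1) ^ Suc k * (1 / (?x\<^sup>2 * (2 * ?x + a)))"
      unfolding atan_moment_Suc by (simp add: a_def algebra_simps)
    also have "1 / (?x\<^sup>2 * (2 * ?x + a)) =
        1 / a * (1 / ?x\<^sup>2) - 2 / a\<^sup>2 * (1 / ?x) + 4 / a\<^sup>2 * (1 / (2 * ?x + a))"
      using a by (intro partial_fractions_square) auto
    also have "2 * ?x + a = 2 * real (Suc k + n) + 1"
      by (simp add: a_def)
    finally show ?thesis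
      by (simp add: algebra_simps del: of_nat_Suc)
  qed
  moreover have "(\<lambda>k. - (1 / a) * ((- 1) ^ k / (real (Suc k))\<^sup>2) + 2 / a\<^sup>2 * ((- 1) ^ k / real (Suc k))
      + 4 / a\<^sup>2 * ((- 1) ^ Suc k / (2 * real (Suc k + n) + 1))) sums
      (- (1 / a) * (pi\<^sup>2 / 12) + 2 / a\<^sup>2 * ln 2 + 4 / a\<^sup>2 * t)"
    unfolding t_def
    by (intro sums_add sums_mult alternating_squares_sums alternating_harmonic_series_sums leibniz_tail_sums)
  ultimately have "suminf (moment_term n) + suminf (moment_term (Suc n)) =
      - (1 / a) * (pi\<^sup>2 / 12) + 2 / a\<^sup>2 * ln 2 + 4 / a\<^sup>2 * t"
    by (simp add: sums_unique2)
  then show ?thesis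
    unfolding a_def t_def by simp
qed

section \<open>Closed forms up to the starting value \<open>T 0\<close>\<close>

lemma Theta2_0_eq: "Theta2_0 n = suminf (moment_term (Suc n))"
  by (simp add: Theta2_0_def Theta2_0_term_eq)

lemma Theta2_0_Suc:
  "Theta2_0 n + Theta2_0 (Suc n) =
     - pi\<^sup>2 / (12 * (2 * real n + 3)) + 2 * ln 2 / (2 * real n + 3)\<^sup>2
     - 4 * (- 1) ^ n * (pi / 4 - (\<Sum>j\<le>Suc n. (- 1) ^ j / (2 * real j + 1))) / (2 * real n + 3)\<^sup>2"
  using suminf_moment_term_Suc[of "Suc n"] by (simp add: Theta2_0_eq add.commute)

lemma Theta2_0_0: "Theta2_0 0 = - 4 + pi + 2 * ln 2 - pi\<^sup>2 / 12 - suminf (moment_term 0)"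
  using suminf_moment_term_Suc[of 0] by (simp add: Theta2_0_eq)

text \<open>
  In the next two lemmas the finite sums are abstracted to variables, since
  \<open>algebra_simps\<close> would otherwise rewrite their summands.
\<close>
lemma Theta2_0_even_regroup:
  fixes S w2 :: real
  assumes "w2 = 2 * w"
  shows "x0 - 4 - 8 * X1 - 4 * X2 + (1 + X3) * p + (1 - 16 * X4) * 2 * l + (- (1 / 2) + X5) * (q / 6)
      + q / 12 * (2 * u) + 2 * l * (- 16 * v) + (p - 4 * S) * w2 - 4 * y =
    x0 - 4 - 8 * (X1 + S * w) - 4 * (X2 + y) + (1 + (X3 + w2)) * p + (1 - 16 * (X4 + v)) * 2 * l
      + (- (1 / 2) + (X5 + u)) * (q / 6)"
  using assms by (simp add: algebra_simps)

lemma Theta2_0_odd_regroup: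
  fixes S w2 :: real
  assumes "w2 = 2 * w"
  shows "x0 + 116 / 27 + 8 * X1 - 4 * X2 + (- (10 / 9) - X3) * p - (1 / 9 + X4) * 16 * l
      + (1 / 18 + 1 / 6 * X5) * q
      + q / 12 * (2 * u) + 2 * l * (- 8 * v) - (p - 4 * S) * w2 - 4 * y =
    x0 + 116 / 27 + 8 * (X1 + S * w) - 4 * (X2 + y) + (- (10 / 9) - (X3 + w2)) * p
      - (1 / 9 + (X4 + v)) * 16 * l + (1 / 18 + 1 / 6 * (X5 + u)) * q"
  using assms by (simp add: algebra_simps)

text \<open>Subtracting two consecutive recurrences eliminates the middle value \<open>t1\<close>.
  The cubic term stems from \<open>1 / c\<close>, the newest term of the Leibniz partial sum. The
  letters \<open>p\<close>, \<open>q\<close> and \<open>l\<close> stand for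
  \<open>pi\<^sup>2\<close>, \<open>pi\<close> and \<open>ln 2\<close>.\<close>

lemma Theta2_0_even_step:
  fixes c d :: real
  assumes "t0 + t1 = - p / (12 * d) + 2 * l / d\<^sup>2 - 4 * (q / 4 - S) / d\<^sup>2"
    and "t1 + t2 = - p / (12 * c) + 2 * l / c\<^sup>2 - 4 * (- 1) * (q / 4 - (S + 1 / c)) / c\<^sup>2"
  shows "t2 = t0 + p / 12 * (1 / d - 1 / c) + 2 * l * (1 / c\<^sup>2 - 1 / d\<^sup>2)
      + (q - 4 * S) * (1 / c\<^sup>2 + 1 / d\<^sup>2) - 4 * (1 / c ^ 3)"
proof -
  have "t2 = t0 + (- p / (12 * c) + 2 * l / c\<^sup>2 - 4 * (- 1) * (q / 4 - (S + 1 / c)) / c\<^sup>2)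
      - (- p / (12 * d) + 2 * l / d\<^sup>2 - 4 * (q / 4 - S) / d\<^sup>2)"
    using assms by linarith
  then show ?thesis
    by (simp add: algebra_simps diff_divide_distrib add_divide_distrib power3_eq_cube power2_eq_square)
qed

text \<open>As in the even case, but the two recurrences carry the opposite signs and the newest
  Leibniz term is \<open>- 1 / c\<close>.\<close>

lemma Theta2_0_odd_step:
  fixes c d :: real
  assumes "t0 + t1 = - p / (12 * d) + 2 * l / d\<^sup>2 - 4 * (- 1) * (q / 4 - S) / d\<^sup>2"
    and "t1 + t2 = - p / (12 * c) + 2 * l / c\<^sup>2 - 4 * (q / 4 - (S - 1 / c)) / c\<^sup>2"
  shows "t2 = t0 + p / 12 * (1 / d - 1 / c) + 2 * l * (1 / c\<^sup>2 - 1 / d\<^sup>2)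
      - (q - 4 * S) * (1 / c\<^sup>2 + 1 / d\<^sup>2) - 4 * (1 / c ^ 3)"
proof -
  have "t2 = t0 + (- p / (12 * c) + 2 * l / c\<^sup>2 - 4 * (q / 4 - (S - 1 / c)) / c\<^sup>2)
      - (- p / (12 * d) + 2 * l / d\<^sup>2 - 4 * (- 1) * (q / 4 - S) / d\<^sup>2)"
    using assms by linarith
  then show ?thesis
    by (simp add: algebra_simps diff_divide_distrib add_divide_distrib power3_eq_cube power2_eq_square)
qed

text \<open>Induction in steps of two for the index: every step appends one summand to each finite
  sum and leaves the contribution of \<open>T 0\<close> unchanged.\<close>

lemma Theta2_0_even:
  "Theta2_0 (2 * m) = - suminf (moment_term 0) - 4
        - 8 * (\<Sum>k<m. \<Sum>j=0..2*k + 1.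
                 (- 1)^j * (16 * real k^2 + 32 * real k + 17)
                   / ((2 * real j + 1) * (4 * real k + 5)^2 * (4 * real k + 3)^2))
        - 4 * (\<Sum>j<m. 1 / (4 * real j + 5)^3)
        + (1 + (\<Sum>j<m. 2 * (16 * real j^2 + 32 * real j + 17)
                 / ((4 * real j + 5)^2 * (4 * real j + 3)^2))) * pi
        + (1 - 16 * (\<Sum>j<m. (real j + 1)
                 / ((4 * real j + 5)^2 * (4 * real j + 3)^2))) * 2 * ln 2
        + (- (1 / 2) + (\<Sum>j<m. 1 / ((4 * real j + 5) * (4 * real j + 3)))) * (pi^2 / 6)"
proof (induction m)
  case 0
  then show ?case by (simp add: Theta2_0_0)
next
  case (Suc m)
  define S where "S = (\<Sum>j\<le>2*m + 1. (- 1) ^ j / (2 * real j + 1))"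
  define c d where "c = 4 * real m + 5" and "d = 4 * real m + 3"
  have pos: "c > 0" "d > 0" by (simp_all add: c_def d_def)
  have "Theta2_0 (2 * m) + Theta2_0 (Suc (2 * m)) =
      - pi\<^sup>2 / (12 * d) + 2 * ln 2 / d\<^sup>2 - 4 * (pi / 4 - S) / d\<^sup>2"
    using Theta2_0_Suc[of "2 * m"] by (simp add: S_def d_def)
  moreover have "Theta2_0 (Suc (2 * m)) + Theta2_0 (2 * Suc m) =
      - pi\<^sup>2 / (12 * c) + 2 * ln 2 / c\<^sup>2 - 4 * (- 1) * (pi / 4 - (S + 1 / c)) / c\<^sup>2"
  proof -
    have "(\<Sum>j\<le>Suc (Suc (2 * m)). (- 1) ^ j / (2 * real j + 1)) = S + 1 / c"
      by (simp add: S_def c_def)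
    moreover have "2 * real (Suc (2 * m)) + 3 = c" "(- 1) ^ Suc (2 * m) = (- 1 :: real)"
      "2 * Suc m = Suc (Suc (2 * m))" by (simp_all add: c_def)
    ultimately show ?thesis
      using Theta2_0_Suc[of "Suc (2 * m)"] by (simp only:)
  qed
  ultimately have step: "Theta2_0 (2 * Suc m) = Theta2_0 (2 * m)
      + pi\<^sup>2 / 12 * (1 / d - 1 / c) + 2 * ln 2 * (1 / c\<^sup>2 - 1 / d\<^sup>2)
      + (pi - 4 * S) * (1 / c\<^sup>2 + 1 / d\<^sup>2) - 4 * (1 / c ^ 3)"
    by (rule Theta2_0_even_step)
  \<comment> \<open>The coefficient does not depend on \<open>j\<close>, so the new double-sum term
    is a multiple of the Leibniz partial sum \<open>S\<close>.\<close>
  have inner: "(\<Sum>j=0..2*m + 1. (- 1)^j * (16 * real m^2 + 32 * real m + 17)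
      / ((2 * real j + 1) * (4 * real m + 5)^2 * (4 * real m + 3)^2)) =
      S * ((16 * real m^2 + 32 * real m + 17) / (c^2 * d^2))"
    unfolding S_def sum_distrib_right atLeast0AtMost c_def d_def by (intro sum.cong) auto
  \<comment> \<open>The numerators come from \<open>c\<^sup>2 + d\<^sup>2\<close>, from
    \<open>c - d = 2\<close>, and from \<open>c + d = 8 * (m + 1)\<close>.\<close>
  have sq: "1 / c\<^sup>2 + 1 / d\<^sup>2 = 2 * (16 * real m^2 + 32 * real m + 17) / (c^2 * d^2)"
    using pos by (simp add: divide_simps) (simp add: c_def d_def power2_eq_square algebra_simps)
  have df: "1 / d - 1 / c = 2 * (1 / (c * d))"
    using pos by (simp add: divide_simps) (simp add: c_def d_def)
  have dsq: "1 / c\<^sup>2 - 1 / d\<^sup>2 = - 16 * ((real m + 1) / (c\<^sup>2 * d\<^sup>2))"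
    using pos by (simp add: divide_simps) (simp add: c_def d_def power2_eq_square algebra_simps)
  show ?case
    unfolding step sum.lessThan_Suc inner Suc.IH sq df dsq
    unfolding c_def d_def by (rule Theta2_0_even_regroup) simp
qed

lemma Theta2_0_odd:
  "Theta2_0 (Suc (2 * m)) = suminf (moment_term 0) + 116 / 27
        + 8 * (\<Sum>k=1..m. \<Sum>j=0..2*k.
                 (- 1)^j * (16 * real k^2 + 16 * real k + 5)
                   / ((2 * real j + 1) * (4 * real k + 3)^2 * (4 * real k + 1)^2))
        - 4 * (\<Sum>j=1..m. 1 / (4 * real j + 3)^3)
        + (- (10 / 9) - (\<Sum>j=1..m. 2 * (16 * real j^2 + 16 * real j + 5)
                 / ((4 * real j + 3)^2 * (4 * real j + 1)^2))) * pi
        - (1 / 9 + (\<Sum>j=1..m. (2 * real j + 1)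
                 / ((4 * real j + 3)^2 * (4 * real j + 1)^2))) * 16 * ln 2
        + (1 / 18 + 1 / 6 * (\<Sum>j=1..m. 1 / ((4 * real j + 3) * (4 * real j + 1)))) * pi^2"
proof (induction m)
  case 0
  \<comment> \<open>One recurrence step from index 0 produces the constants:
    \<open>116 / 27 = 4 + 8 / 27\<close>, \<open>10 / 9 = 1 + 1 / 9\<close>,
    \<open>16 / 9 = 2 - 2 / 9\<close> and \<open>1 / 18 = 1 / 12 - 1 / 36\<close>.\<close>
  then show ?case using Theta2_0_Suc[of 0] by (simp add: Theta2_0_0 field_simps)
next
  case (Suc m)
  let ?k = "real (Suc m)"
  define S where "S = (\<Sum>j\<le>2 * Suc m. (- 1) ^ j / (2 * real j + 1))"
  define c d where "c = 4 * ?k + 3" and "d = 4 * ?k + 1"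
  have pos: "c > 0" "d > 0" by (simp_all add: c_def d_def)
  have "Theta2_0 (Suc (2 * m)) + Theta2_0 (2 * Suc m) =
      - pi\<^sup>2 / (12 * d) + 2 * ln 2 / d\<^sup>2 - 4 * (- 1) * (pi / 4 - S) / d\<^sup>2"
  proof -
    have "2 * real (Suc (2 * m)) + 3 = d" "(- 1) ^ Suc (2 * m) = (- 1 :: real)"
      "2 * Suc m = Suc (Suc (2 * m))" by (simp_all add: d_def)
    then show ?thesis
      using Theta2_0_Suc[of "Suc (2 * m)"] unfolding S_def by (simp only:)
  qed
  moreover have "Theta2_0 (2 * Suc m) + Theta2_0 (Suc (2 * Suc m)) =
      - pi\<^sup>2 / (12 * c) + 2 * ln 2 / c\<^sup>2 - 4 * (pi / 4 - (S - 1 / c)) / c\<^sup>2"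
    using Theta2_0_Suc[of "2 * Suc m"] by (simp add: S_def c_def add.commute)
  ultimately have step: "Theta2_0 (Suc (2 * Suc m)) = Theta2_0 (Suc (2 * m))
      + pi\<^sup>2 / 12 * (1 / d - 1 / c) + 2 * ln 2 * (1 / c\<^sup>2 - 1 / d\<^sup>2)
      - (pi - 4 * S) * (1 / c\<^sup>2 + 1 / d\<^sup>2) - 4 * (1 / c ^ 3)"
    by (rule Theta2_0_odd_step)
  have inner: "(\<Sum>j=0..2*Suc m. (- 1)^j * (16 * ?k^2 + 16 * ?k + 5)
      / ((2 * real j + 1) * (4 * ?k + 3)^2 * (4 * ?k + 1)^2)) =
      S * ((16 * ?k^2 + 16 * ?k + 5) / (c^2 * d^2))"
    unfolding S_def sum_distrib_right atLeast0AtMost c_def d_def by (intro sum.cong) auto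
  have sq: "1 / c\<^sup>2 + 1 / d\<^sup>2 = 2 * (16 * ?k^2 + 16 * ?k + 5) / (c^2 * d^2)"
    using pos by (simp add: divide_simps) (simp add: c_def d_def power2_eq_square algebra_simps)
  have df: "1 / d - 1 / c = 2 * (1 / (c * d))"
    using pos by (simp add: divide_simps) (simp add: c_def d_def)
  have dsq: "1 / c\<^sup>2 - 1 / d\<^sup>2 = - 8 * ((2 * ?k + 1) / (c\<^sup>2 * d\<^sup>2))"
    using pos by (simp add: divide_simps) (simp add: c_def d_def power2_eq_square algebra_simps)
  \<comment> \<open>The fixed lower bound 1 peels the last summand off the outer sums while the
    inner sums, which start at 0, stay intact.\<close>
  have sum_Suc: "(\<Sum>j=1..Suc m. f j) = (\<Sum>j=1..m. f j) + f (Suc m)" for f :: "nat \<Rightarrow> real"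
    by simp
  show ?case
    unfolding step sum_Suc inner Suc.IH sq df dsq
    unfolding c_def d_def by (rule Theta2_0_odd_regroup) simp
qed

subsection \<open>The dilogarithm on the slit plane\<close>

text \<open>A predicate lets a single differentiation lemma serve the orders 1, 2 and 3.\<close>

definition is_polylog :: "nat \<Rightarrow> (complex \<Rightarrow> complex) \<Rightarrow> bool" where
  "is_polylog s f \<longleftrightarrow> f holomorphic_on slit_plane
     \<and> (\<forall>u\<in>ball 0 1. (\<lambda>k. u ^ Suc k / of_nat (Suc k) ^ s) sums f u)"

lemma is_polylogD:
  assumes "is_polylog s f"
  shows "f holomorphic_on slit_plane"
    and "norm u < 1 \<Longrightarrow> (\<lambda>k. u ^ Suc k / of_nat (Suc k) ^ s) sums f u"
  using assms by (auto simp: is_polylog_def)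

lemma is_polylog_DERIV:
  assumes "is_polylog s f" "z \<in> slit_plane"
  shows "(f has_field_derivative deriv f z) (at z)"
  by (rule holomorphic_derivI[OF is_polylogD(1)[OF assms(1)] open_slit_plane assms(2)])

text \<open>The power series has real coefficients.\<close>

lemma is_polylog_Im_of_real:
  assumes "is_polylog s f" "\<bar>x\<bar> < 1"
  shows "Im (f (of_real x)) = 0"
proof -
  have "(\<lambda>k. complex_of_real (x ^ Suc k / real (Suc k) ^ s)) sums f (of_real x)"
    using is_polylogD(2)[OF assms(1), of "of_real x"] assms(2) by simp
  then have "(\<lambda>k. Im (complex_of_real (x ^ Suc k / real (Suc k) ^ s))) sums Im (f (of_real x))"
    by (simp only: sums_complex_iff)
  then have "(\<lambda>_. 0) sums Im (f (of_real x))"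
    by (simp only: Im_complex_of_real)
  then show ?thesis
    using sums_unique2[OF sums_zero] by force
qed

text \<open>Termwise differentiation proves the identity on the unit disc, and the identity theorem
  extends it. The product form keeps both sides holomorphic at 0.\<close>

lemma polylog_deriv:
  assumes f: "is_polylog (Suc s) f" and g: "is_polylog s g" and z: "z \<in> slit_plane"
  shows "z * deriv f z = g z"
proof (rule analytic_continuation_open[of "ball 0 1" slit_plane "\<lambda>z. z * deriv f z" g])
  fix z :: complex assume z: "z \<in> ball 0 1"
  \<comment> \<open>The coefficients are re-indexed from 0 with vanishing constant term, as termwise
    differentiation of a power series expects.\<close>
  define b where "b n = (if n = 0 then 0 else 1 / (of_nat n ^ Suc s :: complex))" for n
  have b_sums: "(\<lambda>n. b n * u ^ n) sums f u" if "norm u < 1" for u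
  proof -
    have "(\<lambda>n. b (Suc n) * u ^ Suc n) sums f u"
      using is_polylogD(2)[OF f that] by (simp add: b_def del: of_nat_Suc)
    then show ?thesis
      by (subst (asm) sums_Suc_iff) (simp add: b_def)
  qed
  have "(\<lambda>n. diffs b n * z ^ n) sums deriv f z"
  proof (rule termdiffs_sums_strong[where f = f])
    show "(f has_field_derivative deriv f z) (at z)"
      using is_polylog_DERIV[OF f] unit_ball_subset_slit_plane z by auto
  qed (use b_sums z in auto)
  then have "(\<lambda>n. z * (diffs b n * z ^ n)) sums (z * deriv f z)"
    by (rule sums_mult)
  moreover have "z * (diffs b n * z ^ n) = z ^ Suc n / of_nat (Suc n) ^ s" for n
    by (simp add: diffs_def b_def del: of_nat_Suc)
  ultimately have "(\<lambda>n. z ^ Suc n / of_nat (Suc n) ^ s) sums (z * deriv f z)"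
    by (simp only:)
  then show "z * deriv f z = g z"
    using is_polylogD(2)[OF g, of z] z by (auto intro: sums_unique2)
next
  show "(\<lambda>z. z * deriv f z) holomorphic_on slit_plane"
    by (intro holomorphic_intros holomorphic_deriv is_polylogD(1)[OF f] open_slit_plane)
qed (use z open_slit_plane unit_ball_subset_slit_plane is_polylogD(1)[OF g]
      starlike_imp_connected[OF starlike_slit_plane] in auto)

lemma one_minus_slit_plane: "z \<in> slit_plane \<Longrightarrow> 1 - z \<notin> \<real>\<^sub>\<le>\<^sub>0"
  by (auto simp: in_slit_plane_iff complex_nonpos_Reals_iff)

lemma is_polylog_1: "is_polylog 1 (\<lambda>z. - Ln (1 - z))"
  unfolding is_polylog_def
proof (intro conjI ballI)
  show "(\<lambda>z. - Ln (1 - z)) holomorphic_on slit_plane"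
    by (intro holomorphic_intros) (auto dest: one_minus_slit_plane)
next
  fix u :: complex assume "u \<in> ball 0 1"
  then have "(\<lambda>n. - (- (u ^ n) / of_nat n)) sums (- ln (1 - u))"
    using Ln_series'[of "- u"] by (intro sums_minus) simp
  \<comment> \<open>The term at \<open>n = 0\<close> is a division by zero, hence 0, so the index
    shift leaves the sum unchanged.\<close>
  then show "(\<lambda>k. u ^ Suc k / of_nat (Suc k) ^ 1) sums (- Ln (1 - u))"
    using sums_Suc_iff[of "\<lambda>n. - (- (u ^ n) / of_nat n)"] by (simp del: of_nat_Suc)
qed

text \<open>Analytic continuation fixes the chosen function on the slit plane; its values on the cut
  are arbitrary.\<close>

definition Li2 :: "complex \<Rightarrow> complex" where
  "Li2 = (SOME f. is_polylog 2 f)"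

lemma is_polylog_2: "is_polylog 2 Li2"
proof -
  have "\<exists>f. is_polylog 2 f"
    unfolding is_polylog_def by (rule polylog_continuation_exists)
  then show ?thesis
    unfolding Li2_def by (rule someI_ex)
qed

lemma is_polylog_3: "is_polylog 3 Li3"
proof -
  obtain f where f: "is_polylog 3 f"
    using polylog_continuation_exists[of 3] by (auto simp: is_polylog_def)
  then have "f u = Li3_series u" if "u \<in> ball 0 1" for u
    using that sums_unique is_polylogD(2)[OF f, of u] unfolding Li3_series_def by auto
  then have "Li3 z = f z" if "z \<in> slit_plane" for z
    using Li3_unique is_polylogD(1)[OF f] that by blast
  then show ?thesis
    using f Li3_holomorphic unit_ball_subset_slit_plane by (auto simp: is_polylog_def)
qed

lemma DERIV_Li2:
  assumes "z \<in> slit_plane" "z \<noteq> 0"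
  shows "(Li2 has_field_derivative - Ln (1 - z) / z) (at z)"
proof -
  have "z * deriv Li2 z = - Ln (1 - z)"
    using polylog_deriv[of 1, OF _ is_polylog_1 assms(1)] is_polylog_2 by (simp add: numeral_2_eq_2)
  then have "deriv Li2 z = - Ln (1 - z) / z"
    using assms(2) by (simp add: field_simps)
  then show ?thesis
    using is_polylog_DERIV[OF is_polylog_2 assms(1)] by simp
qed

lemma DERIV_Li3:
  assumes "z \<in> slit_plane" "z \<noteq> 0"
  shows "(Li3 has_field_derivative Li2 z / z) (at z)"
proof -
  have "z * deriv Li3 z = Li2 z"
    using polylog_deriv[of 2, OF _ is_polylog_2 assms(1)] is_polylog_3 by (simp add: numeral_3_eq_3 numeral_2_eq_2)
  then have "deriv Li3 z = Li2 z / z"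
    using assms(2) by (simp add: field_simps)
  then show ?thesis
    using is_polylog_DERIV[OF is_polylog_3 assms(1)] by simp
qed

section \<open>The dilogarithm series on the closed unit disc\<close>

text \<open>Unlike \<open>Li2\<close>, the series has a definite value at 1, which the reflection
  formula uses.\<close>

definition Li2_series :: "complex \<Rightarrow> complex" where
  "Li2_series z = (\<Sum>k. z ^ Suc k / of_nat (Suc k) ^ 2)"

lemma Li2_term_bound:
  assumes "norm z \<le> 1"
  shows "norm (z ^ Suc k / of_nat (Suc k) ^ 2 :: complex) \<le> 1 / real (Suc k) ^ 2"
proof -
  have "norm z ^ Suc k \<le> 1" using assms by (intro power_le_one) auto
  then show ?thesis
    by (simp add: norm_divide norm_power divide_right_mono del: of_nat_Suc power_Suc)
qed

lemma Li2_series_uniform_limit: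
  "uniform_limit (cball 0 1) (\<lambda>n z. \<Sum>k<n. z ^ Suc k / of_nat (Suc k) ^ 2) Li2_series sequentially"
  unfolding Li2_series_def[abs_def]
  by (rule Weierstrass_m_test[OF _ summable_inverse_Suc_squares], rule Li2_term_bound) auto

lemma Li2_series_continuous: "continuous_on (cball 0 1) Li2_series"
  by (rule uniform_limit_theorem[OF _ Li2_series_uniform_limit])
     (auto intro!: always_eventually continuous_intros simp del: of_nat_Suc)

text \<open>Both sides are continuous on the part of the closed disc inside the slit plane and agree
  on the open disc, which has \<open>z\<close> as a limit point.\<close>

lemma Li2_eq_series:
  assumes z: "z \<in> slit_plane" "norm z \<le> 1"
  shows "Li2 z = Li2_series z"
proof -
  let ?S = "cball 0 1 \<inter> slit_plane"
  have "((\<lambda>w. Li2 w - Li2_series w) \<longlongrightarrow> Li2 z - Li2_series z) (at z within ball 0 1)"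
  proof (rule tendsto_within_subset)
    have "continuous_on ?S (\<lambda>w. Li2 w - Li2_series w)"
      by (intro continuous_intros continuous_on_subset[OF Li2_series_continuous]
            continuous_on_subset[OF holomorphic_on_imp_continuous_on[OF is_polylogD(1)[OF is_polylog_2]]]) auto
    with z show "((\<lambda>w. Li2 w - Li2_series w) \<longlongrightarrow> Li2 z - Li2_series z) (at z within ?S)"
      by (auto simp: continuous_on_def)
    show "ball 0 1 \<subseteq> ?S" using unit_ball_subset_slit_plane by auto
  qed
  moreover have "\<forall>\<^sub>F w in at z within ball 0 1. Li2 w - Li2_series w = 0"
    by (auto simp: eventually_at_filter Li2_series_def simp del: of_nat_Suc power_Suc
        intro!: always_eventually sums_unique is_polylogD(2)[OF is_polylog_2])
  ultimately have "((\<lambda>_. 0) \<longlongrightarrow> Li2 z - Li2_series z) (at z within ball 0 1)"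
    by (rule Lim_transform_eventually)
  moreover have "z islimpt ball 0 1"
    using z by (simp add: islimpt_ball)
  ultimately have "Li2 z - Li2_series z = 0"
    by (metis tendsto_const_iff trivial_limit_within)
  then show ?thesis by simp
qed

lemma Li2_sums:
  assumes "z \<in> slit_plane" "norm z \<le> 1"
  shows "(\<lambda>k. z ^ Suc k / of_nat (Suc k) ^ 2) sums Li2 z"
proof -
  have "summable (\<lambda>k. z ^ Suc k / of_nat (Suc k) ^ 2)"
    by (rule summable_comparison_test'[OF summable_inverse_Suc_squares Li2_term_bound[OF assms(2)]])
  then show ?thesis
    by (simp only: Li2_eq_series[OF assms] Li2_series_def summable_sums)
qed

section \<open>The reflection formula for the dilogarithm\<close>

text \<open>Removing the real rays up to 0 and from 1 on makes the logarithms and polylogarithms at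
  both \<open>z\<close> and \<open>1 - z\<close> holomorphic.\<close>

definition double_slit_plane :: "complex set" where
  "double_slit_plane = {z. Im z \<noteq> 0 \<or> 0 < Re z \<and> Re z < 1}"

lemma double_slit_planeD:
  assumes "z \<in> double_slit_plane"
  shows "z \<in> slit_plane" "1 - z \<in> slit_plane" "z \<notin> \<real>\<^sub>\<le>\<^sub>0" "1 - z \<notin> \<real>\<^sub>\<le>\<^sub>0" "z \<noteq> 0" "z \<noteq> 1"
  using assms by (auto simp: double_slit_plane_def in_slit_plane_iff complex_nonpos_Reals_iff)

text \<open>A vertical strip overlapping two half-planes: open convex pieces from which openness and
  connectedness follow.\<close>

lemma double_slit_plane_eq:
  "double_slit_plane = {z. 0 < Re z} \<inter> {z. Re z < 1} \<union> {z. Im z > 0} \<union> {z. Im z < 0}"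
  by (auto simp: double_slit_plane_def)

lemma open_double_slit_plane: "open double_slit_plane"
  unfolding double_slit_plane_eq
  by (intro open_Un open_Int open_halfspace_Re_gt open_halfspace_Re_lt
        open_halfspace_Im_gt open_halfspace_Im_lt)

lemma connected_double_slit_plane: "connected double_slit_plane"
  unfolding double_slit_plane_eq
proof (intro connected_Un convex_connected convex_Int convex_halfspace_Re_gt convex_halfspace_Re_lt
        convex_halfspace_Im_gt convex_halfspace_Im_lt)
  have "Complex (1/2) 1 \<in> {z. 0 < Re z} \<inter> {z. Re z < 1} \<inter> {z. Im z > 0}" by simp
  then show "{z. 0 < Re z} \<inter> {z. Re z < 1} \<inter> {z. Im z > 0} \<noteq> {}" by blast
  have "Complex (1/2) (-1) \<in> ({z. 0 < Re z} \<inter> {z. Re z < 1} \<union> {z. Im z > 0}) \<inter> {z. Im z < 0}" by simp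
  then show "({z. 0 < Re z} \<inter> {z. Re z < 1} \<union> {z. Im z > 0}) \<inter> {z. Im z < 0} \<noteq> {}" by blast
qed

lemma double_slit_plane_constant:
  assumes "\<And>z. z \<in> double_slit_plane \<Longrightarrow> (f has_field_derivative 0) (at z)"
    and "z \<in> double_slit_plane" "w \<in> double_slit_plane"
  shows "f z = (f w :: complex)"
  using has_field_derivative_0_imp_constant_on[OF assms(1) connected_double_slit_plane open_double_slit_plane]
    assms(2,3) unfolding constant_on_def by metis

lemma DERIV_one_minus:
  "(f has_field_derivative D) (at (1 - z)) \<Longrightarrow> ((\<lambda>z. f (1 - z)) has_field_derivative - D) (at (z::complex))"
  using DERIV_chain2[of f D "\<lambda>z. 1 - z" z "-1"] by (force intro!: derivative_eq_intros)

text \<open>The derivative of the left side vanishes, so it is constant on the connected domain. The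
  constant is the limit along real \<open>t\<close> decreasing to 0, where the product of logarithms
  vanishes and the dilogarithms tend to the series values at 0 and 1.\<close>

lemma Li2_reflection:
  assumes z: "z \<in> double_slit_plane"
  shows "Li2 z + Li2 (1 - z) + Ln z * Ln (1 - z) = of_real (pi\<^sup>2 / 6)"
proof -
  define R where "R z = Li2 z + Li2 (1 - z) + Ln z * Ln (1 - z)" for z
  have deriv: "(R has_field_derivative 0) (at z)" if z: "z \<in> double_slit_plane" for z
  proof -
    note dz = double_slit_planeD[OF z]
    have ne: "1 - z \<noteq> 0" using dz by auto
    have L: "((\<lambda>z. Ln (1 - z)) has_field_derivative - (1 / (1 - z))) (at z)"
      using dz by (intro DERIV_one_minus has_field_derivative_Ln[THEN DERIV_cong]) (auto simp: inverse_eq_divide)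
    have "(R has_field_derivative - Ln (1 - z) / z + - (- Ln (1 - (1 - z)) / (1 - z))
        + (1 / z * Ln (1 - z) + - (1 / (1 - z)) * Ln z)) (at z)"
      unfolding R_def
      using dz ne by (intro DERIV_add DERIV_mult DERIV_Li2 DERIV_one_minus L
          has_field_derivative_Ln[THEN DERIV_cong]) (auto simp: inverse_eq_divide)
    moreover have "- Ln (1 - z) / z + - (- Ln (1 - (1 - z)) / (1 - z))
        + (1 / z * Ln (1 - z) + - (1 / (1 - z)) * Ln z) = 0"
      by simp
    ultimately show ?thesis by metis
  qed
  \<comment> \<open>On the real interval the series replaces \<open>Li2\<close>, because the series
    is continuous up to the point 1 on the cut.\<close>
  have R_real: "R (of_real t) = Li2_series (of_real t) + Li2_series (of_real (1 - t)) + of_real (ln t * ln (1 - t))"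
    if "0 < t" "t < 1" for t :: real
  proof -
    have "Li2 (of_real t) = Li2_series (of_real t)" "Li2 (of_real (1 - t)) = Li2_series (of_real (1 - t))"
      using that by (intro Li2_eq_series; simp add: in_slit_plane_iff del: of_real_diff)+
    moreover have "Ln (of_real t) = of_real (ln t)" "Ln (of_real (1 - t)) = of_real (ln (1 - t))"
      using that by (intro Ln_of_real; simp)+
    ultimately show ?thesis
      by (simp add: R_def)
  qed
  have at_eq: "((\<lambda>t. R (of_real t)) \<longlongrightarrow> R z) (at_right 0)"
  proof (rule tendsto_eventually)
    have "\<forall>\<^sub>F t::real in at_right 0. 0 < t \<and> t < 1"
      using eventually_at_right_less[of 0] eventually_at_right_real[of 0 1] by (auto elim: eventually_elim2)
    then show "\<forall>\<^sub>F t::real in at_right 0. R (of_real t) = R z"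
    proof eventually_elim
      case (elim t)
      then show ?case
        by (intro double_slit_plane_constant[OF deriv] z) (auto simp: double_slit_plane_def)
    qed
  qed
  have "((\<lambda>t. Li2_series (of_real t) + Li2_series (of_real (1 - t)) + of_real (ln t * ln (1 - t)))
      \<longlongrightarrow> Li2_series (of_real 0) + Li2_series (of_real (1 - 0)) + of_real 0) (at_right 0)"
  proof (intro tendsto_add tendsto_of_real)
    have "continuous_on {0..1} (\<lambda>t::real. Li2_series (of_real t))"
      by (rule continuous_on_compose2[OF Li2_series_continuous]) (auto intro!: continuous_intros)
    then show "((\<lambda>t. Li2_series (of_real t)) \<longlongrightarrow> Li2_series (of_real 0)) (at_right 0)"
      by (rule continuous_on_Icc_at_rightD[OF _ zero_less_one])
    have c: "continuous_on {0..1} (\<lambda>t::real. Li2_series (of_real (1 - t)))"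
      by (rule continuous_on_compose2[OF Li2_series_continuous]) (auto intro!: continuous_intros simp flip: of_real_diff)
    show "((\<lambda>t. Li2_series (of_real (1 - t))) \<longlongrightarrow> Li2_series (of_real (1 - 0))) (at_right 0)"
      by (rule continuous_on_Icc_at_rightD[OF c zero_less_one])
    show "((\<lambda>t::real. ln t * ln (1 - t)) \<longlongrightarrow> 0) (at_right 0)"
      by real_asymp
  qed
  then have "((\<lambda>t. R (of_real t)) \<longlongrightarrow>
      Li2_series (of_real 0) + Li2_series (of_real (1 - 0)) + of_real 0) (at_right 0)"
  proof (rule Lim_transform_eventually)
    have "\<forall>\<^sub>F t::real in at_right 0. 0 < t \<and> t < 1"
      using eventually_at_right_less[of 0] eventually_at_right_real[of 0 1] by (auto elim: eventually_elim2)
    then show "\<forall>\<^sub>F t::real in at_right 0. Li2_series (of_real t) +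
        Li2_series (of_real (1 - t)) + of_real (ln t * ln (1 - t)) = R (of_real t)"
      by eventually_elim (simp only: R_real)
  qed
  then have "R z = Li2_series 0 + Li2_series 1"
    using tendsto_unique[OF _ at_eq] by simp
  moreover have "Li2_series 0 = 0" by (simp add: Li2_series_def)
  moreover have "Li2_series 1 = of_real (pi\<^sup>2 / 6)"
    using sums_unique[OF sums_of_real[OF inverse_squares_sums, where 'a = complex]]
    by (simp add: Li2_series_def add.commute)
  ultimately show ?thesis by (simp add: R_def)
qed

subsection \<open>Evaluation by the trilogarithm\<close>

text \<open>The numerator has a double zero at 0, so the singularity is removable and the starlike
  slit plane admits a primitive. This primitive is regular at 0, where the polylogarithmic one has
  its branch point.\<close>

lemma Ln_square_primitive:
  obtains P where
    "\<And>w. w \<in> slit_plane \<Longrightarrow> (P has_field_derivative (if w = 0 then 0 else (Ln (1 - w))\<^sup>2 / w)) (at w)"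
proof -
  define g where "g w = (Ln (1 - w))\<^sup>2" for w
  define q where "q w = (if w = 0 then 0 else g w / w)" for w
  have g: "g holomorphic_on slit_plane"
    unfolding g_def[abs_def] by (intro holomorphic_intros) (auto dest: one_minus_slit_plane)
  \<comment> \<open>The removable singularity is filled by \<open>deriv g 0\<close>, which must
    equal the 0 chosen in \<open>q\<close>.\<close>
  have "(g has_field_derivative 0) (at 0)"
    unfolding g_def[abs_def] by (auto intro!: derivative_eq_intros)
  then have "deriv g 0 = 0"
    by (rule DERIV_imp_deriv)
  then have q: "q holomorphic_on slit_plane"
    by (intro pole_theorem_open_0[OF g open_slit_plane, of 0]) (auto simp: q_def g_def)
  have "\<exists>P. \<forall>w\<in>slit_plane. (P has_field_derivative q w) (at w)"
    by (rule holomorphic_starlike_primitive[OF holomorphic_on_imp_continuous_on[OF q]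
          starlike_slit_plane open_slit_plane finite.emptyI])
       (use q open_slit_plane holomorphic_on_imp_differentiable_at in auto)
  then show ?thesis
    using that unfolding q_def g_def by blast
qed

text \<open>Among the product-rule terms, those with \<open>Ln z * Ln (1 - z) / (1 - z)\<close>
  cancel, as do those with \<open>Li2 (1 - z) / (1 - z)\<close>.\<close>

lemma Li3_combination_deriv:
  assumes z: "z \<in> double_slit_plane"
  shows "((\<lambda>z. Ln z * (Ln (1 - z))\<^sup>2 + 2 * Ln (1 - z) * Li2 (1 - z) - 2 * Li3 (1 - z))
           has_field_derivative (Ln (1 - z))\<^sup>2 / z) (at z)"
proof -
  note dz = double_slit_planeD[OF z]
  have ne: "1 - z \<noteq> 0" using dz by auto
  have L0: "(Ln has_field_derivative 1 / z) (at z)"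
    using dz by (intro has_field_derivative_Ln[THEN DERIV_cong]) (auto simp: inverse_eq_divide)
  have L: "((\<lambda>z. Ln (1 - z)) has_field_derivative - (1 / (1 - z))) (at z)"
    using dz by (intro DERIV_one_minus has_field_derivative_Ln[THEN DERIV_cong]) (auto simp: inverse_eq_divide)
  have L2: "((\<lambda>z. Li2 (1 - z)) has_field_derivative - (- Ln (1 - (1 - z)) / (1 - z))) (at z)"
    using dz ne by (intro DERIV_one_minus DERIV_Li2)
  have L3: "((\<lambda>z. Li3 (1 - z)) has_field_derivative - (Li2 (1 - z) / (1 - z))) (at z)"
    using dz ne by (intro DERIV_one_minus DERIV_Li3)
  show ?thesis
    by (rule derivative_eq_intros L0 L L2 L3 refl)+
       (use dz ne in \<open>simp add: divide_simps\<close>, simp add: algebra_simps power2_eq_square)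
qed

section \<open>Special values and the change of the primitive along the imaginary axis\<close>

lemma Ln_one_plus_ii: "Ln (1 + \<i>) = Complex (ln 2 / 2) (pi / 4)"
proof -
  have "norm (1 + \<i>) = sqrt 2" by (simp add: cmod_def)
  moreover have "Im (Ln (1 + \<i>)) = pi / 4"
    by (subst Im_Ln_eq) (auto simp: complex_eq_iff arctan_one)
  moreover have "1 + \<i> \<noteq> 0" by (simp add: complex_eq_iff)
  ultimately show ?thesis
    by (simp add: complex_eq_iff ln_sqrt)
qed

lemma minus_ii_double_slit_plane: "- \<i> \<in> double_slit_plane"
  by (simp add: double_slit_plane_def)

text \<open>Grouping the series in pairs separates the parts: odd powers of \<open>- \<i>\<close>
  give the series of Catalan's constant, even powers a quarter of the alternating series of inverse
  squares.\<close>

lemma Li2_minus_ii: "Li2 (- \<i>) = Complex (- (pi\<^sup>2 / 48)) (- catalan_const)"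
proof -
  let ?f = "\<lambda>k. (- \<i>) ^ Suc k / of_nat (Suc k) ^ 2"
  have "?f sums Li2 (- \<i>)"
    by (rule Li2_sums) (simp_all add: in_slit_plane_iff)
  then have "(\<lambda>n. sum ?f {n * 2..<n * 2 + 2}) sums Li2 (- \<i>)"
    by (rule sums_group) simp
  moreover have "sum ?f {n * 2..<n * 2 + 2} =
      Complex (- (1 / 4 * ((- 1) ^ n / (real (Suc n))\<^sup>2))) (- ((- 1) ^ n / (2 * real n + 1)\<^sup>2))" for n
  proof -
    have "{n * 2..<n * 2 + 2} = {n * 2, Suc (n * 2)}" by auto
    moreover have "?f (n * 2) = - \<i> * of_real ((- 1) ^ n / (2 * real n + 1)\<^sup>2)"
      by (simp add: power_mult power_mult_distrib mult.commute[of n 2] add.commute)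
    moreover have "?f (Suc (n * 2)) = of_real (- (1 / 4 * ((- 1) ^ n / (real (Suc n))\<^sup>2)))"
    proof -
      have "of_nat (Suc (Suc (n * 2))) = (2 * of_nat (Suc n) :: complex)" by simp
      moreover have "(- \<i>) ^ Suc (Suc (n * 2)) = - ((- 1) ^ n)"
        by (simp add: power_mult mult.commute[of n 2])
      ultimately show ?thesis
        by (simp only: power_mult_distrib) (simp del: of_nat_Suc)
    qed
    ultimately show ?thesis
      by (simp add: complex_eq_iff del: of_nat_Suc power_Suc)
  qed
  ultimately have *: "(\<lambda>n. Complex (- (1 / 4 * ((- 1) ^ n / (real (Suc n))\<^sup>2)))
      (- ((- 1) ^ n / (2 * real n + 1)\<^sup>2))) sums Li2 (- \<i>)"
    by (simp only:)
  have "(\<lambda>n. - (1 / 4 * ((- 1) ^ n / (real (Suc n))\<^sup>2))) sums Re (Li2 (- \<i>))"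
    using * by (simp add: sums_complex_iff)
  moreover have "(\<lambda>n. - (1 / 4 * ((- 1) ^ n / (real (Suc n))\<^sup>2))) sums (- (1 / 4 * (pi\<^sup>2 / 12)))"
    by (intro sums_minus sums_mult alternating_squares_sums)
  ultimately have re: "Re (Li2 (- \<i>)) = - (1 / 4 * (pi\<^sup>2 / 12))"
    by (rule sums_unique2)
  have "(\<lambda>n. - ((- 1) ^ n / (2 * real n + 1)\<^sup>2)) sums Im (Li2 (- \<i>))"
    using * by (simp add: sums_complex_iff)
  then have "(\<lambda>n. (- 1) ^ n / (2 * real n + 1)\<^sup>2) sums (- Im (Li2 (- \<i>)))"
    using sums_minus by fastforce
  then have "catalan_const = - Im (Li2 (- \<i>))"
    unfolding catalan_const_def by (rule sums_unique[symmetric])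
  with re show ?thesis
    by (simp add: complex_eq_iff)
qed

text \<open>The point \<open>1 + \<i>\<close> lies outside the unit disc; reflection at
  \<open>- \<i>\<close> leads back to the unit circle, where the series converges.\<close>

lemma Li2_one_plus_ii: "Li2 (1 + \<i>) = Complex (pi\<^sup>2 / 16) (catalan_const + pi / 4 * ln 2)"
proof -
  have "Li2 (1 + \<i>) = of_real (pi\<^sup>2 / 6) - Li2 (- \<i>) - Ln (- \<i>) * Ln (1 + \<i>)"
    using Li2_reflection[OF minus_ii_double_slit_plane]
    by (simp only: diff_minus_eq_add eq_diff_eq add_ac)
  also have "\<dots> = Complex (pi\<^sup>2 / 16) (catalan_const + pi / 4 * ln 2)"
    unfolding Li2_minus_ii Ln_one_plus_ii
    by (simp add: complex_eq_iff power2_eq_square)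
  finally show ?thesis .
qed

text \<open>
  The two primitives differ by a constant. Its imaginary part is read off at \<open>1/2\<close>, where the
  polylogarithmic primitive is real and \<open>P\<close> has the same imaginary part as at 0.
  So no boundary behaviour of \<^const>\<open>Li3\<close> near 1 from outside the unit disc is needed.
\<close>
lemma Im_Ln_square_primitive:
  assumes P: "\<And>w. w \<in> slit_plane \<Longrightarrow>
      (P has_field_derivative (if w = 0 then 0 else (Ln (1 - w))\<^sup>2 / w)) (at w)"
  shows "Im (P (- \<i>)) - Im (P 0) =
     pi / 8 * (ln 2)\<^sup>2 + pi ^ 3 / 16 + catalan_const * ln 2 - 2 * Im (Li3 (1 + \<i>))"
proof -
  define S where "S z = Ln z * (Ln (1 - z))\<^sup>2 + 2 * Ln (1 - z) * Li2 (1 - z) - 2 * Li3 (1 - z)" for z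
  have "((\<lambda>z. S z - P z) has_field_derivative 0) (at z)" if z: "z \<in> double_slit_plane" for z
    using DERIV_diff[OF Li3_combination_deriv[OF z] P[OF double_slit_planeD(1)[OF z]]]
      double_slit_planeD(5)[OF z] by (simp add: S_def)
  then have "S (- \<i>) - P (- \<i>) = S (of_real (1 / 2)) - P (of_real (1 / 2))"
    by (rule double_slit_plane_constant) (simp_all add: double_slit_plane_def)
  then have eq: "Im (P (- \<i>)) = Im (S (- \<i>)) - Im (S (of_real (1 / 2))) + Im (P (of_real (1 / 2)))"
    by (simp add: complex_eq_iff)
  have "Im (P (of_real (1 / 2))) = Im (P (of_real 0))"
  proof -
    \<comment> \<open>On this segment \<open>Ln (1 - x)\<close> is real, so the derivative of
      \<open>P\<close> is real and its imaginary part stays constant.\<close>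
    have d: "((\<lambda>x. Im (P (of_real x))) has_field_derivative 0) (at x within {0..1/2})"
      if x: "x \<in> {0..1/2}" for x :: real
    proof -
      have "((P \<circ> of_real) has_vector_derivative
          of_real 1 * (if x = 0 then 0 else (Ln (1 - of_real x))\<^sup>2 / of_real x)) (at x)"
        using P[of "of_real x"] x
        by (intro field_vector_diff_chain_at)
           (auto simp: in_slit_plane_iff intro!: derivative_eq_intros)
      then have "((\<lambda>y. Im ((P \<circ> of_real) y)) has_vector_derivative
          Im (of_real 1 * (if x = 0 then 0 else (Ln (1 - of_real x))\<^sup>2 / of_real x))) (at x)"
        by (rule bounded_linear.has_vector_derivative[OF bounded_linear_Im])
      moreover have "Ln (1 - of_real x) = of_real (ln (1 - x))"
        using x Ln_of_real[of "1 - x"] by simp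
      ultimately have "((\<lambda>y. Im (P (of_real y))) has_vector_derivative 0) (at x)"
        by (simp add: o_def split: if_splits flip: of_real_power of_real_divide)
      then show ?thesis
        by (simp add: has_real_derivative_iff_has_vector_derivative has_vector_derivative_at_within)
    qed
    obtain c where "\<And>x. x \<in> {0..1/2} \<Longrightarrow> Im (P (of_real x)) = c"
      using has_field_derivative_zero_constant[OF convex_closed_interval d] by blast
    then show ?thesis by (metis atLeastAtMost_iff divide_nonneg_nonneg order_refl zero_le_numeral zero_le_one)
  qed
  moreover have "Im (S (of_real (1 / 2))) = 0"
  proof -
    have "Ln (of_real (1 / 2)) = of_real (ln (1 / 2))" by (rule Ln_of_real) simp
    moreover have "1 - complex_of_real (1 / 2) = of_real (1 / 2)"
      by (simp add: complex_eq_iff)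
    moreover have "Im (Li2 (of_real (1 / 2))) = 0" "Im (Li3 (of_real (1 / 2))) = 0"
      by (rule is_polylog_Im_of_real[OF is_polylog_2] is_polylog_Im_of_real[OF is_polylog_3]; simp)+
    ultimately show ?thesis
      unfolding S_def by (simp only:) (simp add: power2_eq_square)
  qed
  \<comment> \<open>Here \<open>1 - z\<close> is \<open>1 + \<i>\<close> and
    \<open>Ln (- \<i>)\<close> is \<open>- \<i> * pi / 2\<close>; the first two terms of
    \<open>S\<close> contribute \<open>pi ^ 3 / 32\<close> each.\<close>
  moreover have "Im (S (- \<i>)) =
      pi / 8 * (ln 2)\<^sup>2 + pi ^ 3 / 16 + catalan_const * ln 2 - 2 * Im (Li3 (1 + \<i>))"
    unfolding S_def diff_minus_eq_add Ln_one_plus_ii Li2_one_plus_ii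
    by (simp add: power2_eq_square power3_eq_cube field_simps)
  ultimately show ?thesis
    using eq by simp
qed

section \<open>The starting value as an integral\<close>

lemma minus_square_in_slit_plane: "of_real (- (x\<^sup>2)) \<in> slit_plane"
  using less_le_trans[OF _ zero_le_power2, of "- 1" x] by (simp add: in_slit_plane_iff)

lemma Li2_nonpos_sums:
  assumes "x \<in> {0..1}"
  shows "(\<lambda>k. (- (x\<^sup>2)) ^ Suc k / (real (Suc k))\<^sup>2) sums Re (Li2 (of_real (- (x\<^sup>2))))"
proof -
  have "x\<^sup>2 \<le> 1" using assms by (simp add: power_le_one)
  then have "(\<lambda>k. of_real (- (x\<^sup>2)) ^ Suc k / of_nat (Suc k) ^ 2) sums Li2 (of_real (- (x\<^sup>2)))"
    by (intro Li2_sums minus_square_in_slit_plane) (simp add: norm_power)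
  then have "(\<lambda>k. of_real ((- (x\<^sup>2)) ^ Suc k / (real (Suc k))\<^sup>2)) sums Li2 (of_real (- (x\<^sup>2)))"
    by (simp only: of_real_power of_real_divide of_real_of_nat_eq)
  then show ?thesis
    by (simp only: sums_complex_iff Re_complex_of_real)
qed

text \<open>The M-test with inverse squares gives uniform convergence on the interval, so the
  dilogarithm series may be integrated term by term.\<close>

lemma moment_integral:
  "((\<lambda>x. Re (Li2 (of_real (- (x\<^sup>2)))) / (1 + x\<^sup>2)) has_integral suminf (moment_term 0)) {0..1}"
proof -
  define F where "F N x = (\<Sum>k<N. (- (x\<^sup>2)) ^ Suc k / (real (Suc k))\<^sup>2 / (1 + x\<^sup>2))" for N and x :: real
  define g where "g x = (\<Sum>k. (- (x\<^sup>2)) ^ Suc k / (real (Suc k))\<^sup>2 / (1 + x\<^sup>2))" for x :: real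
  have unif: "uniform_limit {0..1} F g sequentially"
    unfolding F_def[abs_def] g_def[abs_def]
  proof (rule Weierstrass_m_test[OF _ summable_inverse_Suc_squares])
    fix k and x :: real assume x: "x \<in> {0..1}"
    then have "(x\<^sup>2) ^ Suc k \<le> 1" by (intro power_le_one) auto
    then have "(x\<^sup>2) ^ Suc k / (real (Suc k))\<^sup>2 / (1 + x\<^sup>2) \<le> 1 / (real (Suc k))\<^sup>2 / 1"
      by (intro frac_le divide_right_mono) auto
    then show "norm ((- (x\<^sup>2)) ^ Suc k / (real (Suc k))\<^sup>2 / (1 + x\<^sup>2)) \<le> 1 / (real (Suc k))\<^sup>2"
      by (simp add: abs_mult power_abs del: of_nat_Suc power_Suc)
  qed
  have cont: "continuous_on {0..1} (F N)" for N
    unfolding F_def[abs_def] by (intro continuous_intros) (auto simp: one_plus_square_ne)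
  obtain I J where I: "\<And>N. (F N has_integral I N) {0..1}"
    and J: "(g has_integral J) {0..1}" and lim: "I \<longlonglongrightarrow> J"
    using uniform_limit_integral[OF unif cont] by auto
  have "(F N has_integral (\<Sum>k<N. moment_term 0 k)) {0..1}" for N
  proof -
    have "((\<lambda>x. \<Sum>k<N. (- 1) ^ Suc k / (real (Suc k))\<^sup>2 * (x ^ (2 * Suc k) / (1 + x\<^sup>2)))
        has_integral (\<Sum>k<N. (- 1) ^ Suc k / (real (Suc k))\<^sup>2 * atan_moment (Suc k))) {0..1}"
      by (intro has_integral_sum has_integral_mult_right atan_moment_has_integral) simp
    moreover have "(- 1) ^ Suc k / (real (Suc k))\<^sup>2 * (x ^ (2 * Suc k) / (1 + x\<^sup>2)) =
        (- (x\<^sup>2)) ^ Suc k / (real (Suc k))\<^sup>2 / (1 + x\<^sup>2)" for x :: real and k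
    proof -
      have "(- (x\<^sup>2)) ^ Suc k = (- 1) ^ Suc k * x ^ (2 * Suc k)"
        by (simp only: power_minus[of "x\<^sup>2"] power_mult)
      then show ?thesis by (simp only: times_divide_eq_left times_divide_eq_right divide_divide_eq_left)
    qed
    moreover have "(- 1) ^ Suc k / (real (Suc k))\<^sup>2 * atan_moment (Suc k) = moment_term 0 k" for k
      by (simp add: moment_term_def)
    ultimately show ?thesis
      unfolding F_def[abs_def] by (simp only:)
  qed
  then have "I = (\<lambda>N. \<Sum>k<N. moment_term 0 k)"
    using I has_integral_unique by blast
  then have "moment_term 0 sums J"
    using lim by (simp add: sums_def)
  then have "J = suminf (moment_term 0)"
    by (rule sums_unique)
  moreover have "g x = Re (Li2 (of_real (- (x\<^sup>2)))) / (1 + x\<^sup>2)" if "x \<in> {0..1}" for x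
    unfolding g_def by (rule sums_unique[symmetric]) (rule sums_divide[OF Li2_nonpos_sums[OF that]])
  ultimately show ?thesis
    using has_integral_eq[OF _ J] by simp
qed

text \<open>The square of this logarithm has imaginary part
  \<open>arctan x * ln (1 + x\<^sup>2)\<close>, which links the real integral to
  \<open>(Ln (1 - w))\<^sup>2 / w\<close> along the segment from 0 to \<open>- \<i>\<close>.\<close>

lemma Ln_one_plus_ii_times: "Ln (1 + \<i> * of_real x) = Complex (ln (1 + x\<^sup>2) / 2) (arctan x)"
proof -
  have ne: "1 + \<i> * of_real x \<noteq> 0" by (simp add: complex_eq_iff)
  have "Im (Ln (1 + \<i> * of_real x)) = arctan x"
    using ne by (subst Im_Ln_eq) auto
  moreover have "norm (1 + \<i> * of_real x) = sqrt (1 + x\<^sup>2)"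
    by (simp add: cmod_def)
  ultimately show ?thesis
    using ne one_plus_square_pos[of x] by (simp add: complex_eq_iff ln_sqrt)
qed

lemma suminf_moment_term_0:
  "suminf (moment_term 0) =
     pi / 4 * (ln 2)\<^sup>2 + 5 * pi ^ 3 / 48 + 2 * catalan_const * ln 2 - 4 * Im (Li3 (1 + \<i>))"
proof -
  obtain P where P: "\<And>w. w \<in> slit_plane \<Longrightarrow>
      (P has_field_derivative (if w = 0 then 0 else (Ln (1 - w))\<^sup>2 / w)) (at w)"
    using Ln_square_primitive by blast
  define A where "A x = Re (Li2 (of_real (- (x\<^sup>2))))" for x :: real
  define B where "B x = Im (P (- \<i> * of_real x))" for x :: real
  note slitA = minus_square_in_slit_plane
  have slitB: "- \<i> * of_real x \<in> slit_plane" for x :: real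
    by (simp add: in_slit_plane_iff)
  have contA: "continuous_on {0..1} A"
    unfolding A_def[abs_def]
    by (rule continuous_on_Re,
        rule continuous_on_compose2[OF holomorphic_on_imp_continuous_on[OF is_polylogD(1)[OF is_polylog_2]]])
       (use slitA in \<open>auto intro!: continuous_intros simp del: of_real_minus of_real_power\<close>)
  have "continuous_on slit_plane P"
    by (intro continuous_at_imp_continuous_on ballI DERIV_isCont[OF P])
  then have contB: "continuous_on {0..1} B"
    unfolding B_def[abs_def]
    by (intro continuous_on_Im, rule continuous_on_compose2)
       (use slitB in \<open>auto intro!: continuous_intros\<close>)
  have derivA: "(A has_real_derivative - 2 * ln (1 + x\<^sup>2) / x) (at x)" if x: "0 < x" for x
  proof -
    have "((Li2 \<circ> (\<lambda>x. of_real (- (x\<^sup>2)))) has_vector_derivative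
        of_real (- 2 * x) * (- Ln (1 - of_real (- (x\<^sup>2))) / of_real (- (x\<^sup>2)))) (at x)"
      using x slitA
      by (intro field_vector_diff_chain_at DERIV_Li2 has_vector_derivative_of_real)
         (auto intro!: derivative_eq_intros)
    moreover have "of_real (- 2 * x) * (- Ln (1 - of_real (- (x\<^sup>2))) / of_real (- (x\<^sup>2))) =
        complex_of_real (- 2 * ln (1 + x\<^sup>2) / x)"
    proof -
      have "Ln (1 - of_real (- (x\<^sup>2))) = of_real (ln (1 + x\<^sup>2))"
        using Ln_of_real[OF one_plus_square_pos[of x]] by simp
      then show ?thesis
        using x by (simp add: power2_eq_square)
    qed
    ultimately have "((\<lambda>y. Re ((Li2 \<circ> (\<lambda>x. of_real (- (x\<^sup>2)))) y)) has_vector_derivative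
        Re (complex_of_real (- 2 * ln (1 + x\<^sup>2) / x))) (at x)"
      by (intro bounded_linear.has_vector_derivative[OF bounded_linear_Re]) (simp only:)
    then show ?thesis
      unfolding has_real_derivative_iff_has_vector_derivative A_def[abs_def] o_def Re_complex_of_real .
  qed
  have derivB: "(B has_real_derivative arctan x * ln (1 + x\<^sup>2) / x) (at x)" if x: "0 < x" for x
  proof -
    let ?w = "- \<i> * of_real x"
    have "((P \<circ> (\<lambda>x. - \<i> * of_real x)) has_vector_derivative
        (- \<i> * of_real 1) * ((Ln (1 - ?w))\<^sup>2 / ?w)) (at x)"
      using P[OF slitB[of x]] x
      by (intro field_vector_diff_chain_at has_vector_derivative_mult_right has_vector_derivative_of_real)
         (auto intro!: derivative_eq_intros)
    then have "((\<lambda>y. Im ((P \<circ> (\<lambda>x. - \<i> * of_real x)) y)) has_vector_derivative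
        Im ((- \<i> * of_real 1) * ((Ln (1 - ?w))\<^sup>2 / ?w))) (at x)"
      by (rule bounded_linear.has_vector_derivative[OF bounded_linear_Im])
    moreover have "Im ((- \<i> * of_real 1) * ((Ln (1 - ?w))\<^sup>2 / ?w)) = arctan x * ln (1 + x\<^sup>2) / x"
    proof -
      have "(- \<i> * of_real 1) * ((Ln (1 - ?w))\<^sup>2 / ?w) = (Ln (1 + \<i> * of_real x))\<^sup>2 / of_real x"
        using x by simp
      then show ?thesis
        by (simp add: Ln_one_plus_ii_times power2_eq_square)
    qed
    ultimately show ?thesis
      unfolding has_real_derivative_iff_has_vector_derivative B_def[abs_def] o_def by (simp only:)
  qed
  \<comment> \<open>Integration by parts as an explicit primitive: differentiating \<open>A\<close>
    inside the product leaves \<open>- 2 * arctan x * ln (1 + x\<^sup>2) / x\<close>, which the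
    derivative of \<open>2 * B x\<close> cancels.\<close>
  define E where "E x = arctan x * A x + 2 * B x" for x
  have "((\<lambda>x. A x / (1 + x\<^sup>2)) has_integral (E 1 - E 0)) {0..1}"
  \<comment> \<open>The derivative formulas divide by \<open>x\<close>, so the endpoint 0 is reached
    by continuity alone.\<close>
  proof (rule fundamental_theorem_of_calculus_interior)
    show "continuous_on {0..1} E"
      unfolding E_def[abs_def] by (intro continuous_intros contA contB)
    fix x :: real assume "x \<in> {0<..<1}"
    then have x: "0 < x" by simp
    have "(E has_real_derivative A x / (1 + x\<^sup>2)) (at x)"
      unfolding E_def[abs_def]
      by (rule derivative_eq_intros derivA[OF x] derivB[OF x] refl one_plus_square_ne)+
         (use x in \<open>simp add: inverse_eq_divide\<close>)
    then show "(E has_vector_derivative A x / (1 + x\<^sup>2)) (at x)"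
      by (simp add: has_real_derivative_iff_has_vector_derivative)
  qed simp
  then have "suminf (moment_term 0) = E 1 - E 0"
    using has_integral_unique[OF moment_integral] unfolding A_def by blast
  also have "\<dots> = pi / 4 * A 1 + 2 * (Im (P (- \<i>)) - Im (P 0))"
    by (simp add: E_def B_def arctan_one)
  also have "A 1 = - (pi\<^sup>2 / 12)"
  proof -
    have "(\<lambda>k. - ((- 1) ^ k / (real (Suc k))\<^sup>2)) sums A 1"
      using Li2_nonpos_sums[of 1] by (simp add: A_def del: of_nat_Suc)
    then show ?thesis
      using sums_unique2 sums_minus[OF alternating_squares_sums] by blast
  qed
  also note Im_Ln_square_primitive[OF P]
  \<comment> \<open>The \<open>pi ^ 3\<close> terms combine as
    \<open>2 / 16 - 1 / 48 = 5 / 48\<close>.\<close>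
  finally show ?thesis
    by (simp add: algebra_simps power2_eq_square power3_eq_cube)
qed

section \<open>Assembly of the closed forms\<close>

theorem theorem8:
  fixes n :: nat
  shows
  "summable (\<lambda>k. Theta2_0_term n (Suc k))
   \<and> (n = 0 \<longrightarrow>
      Theta2_0 n = - 4 + pi + 2 * ln 2 - pi / 4 * (ln 2)^2 - pi^2 / 12 - 5 * pi^3 / 48
        - 2 * catalan_const * ln 2 + 4 * Im (Li3 (1 + \<i>)))
   \<and> (n = 1 \<longrightarrow>
      Theta2_0 n = 116 / 27 - 10 * pi / 9 - 16 * ln 2 / 9 + pi / 4 * (ln 2)^2 + pi^2 / 18
        + 5 * pi^3 / 48 + 2 * catalan_const * ln 2 - 4 * Im (Li3 (1 + \<i>)))
   \<and> (odd n \<and> n \<noteq> 1 \<longrightarrow>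
      Theta2_0 n = 116 / 27
        + 8 * (\<Sum>k=1..(n - 1) div 2. \<Sum>j=0..2*k.
                 (- 1)^j * (16 * real k^2 + 16 * real k + 5)
                   / ((2 * real j + 1) * (4 * real k + 3)^2 * (4 * real k + 1)^2))
        - 4 * (\<Sum>j=1..(n - 1) div 2. 1 / (4 * real j + 3)^3)
        + (- (10 / 9)
           - (\<Sum>j=1..(n - 1) div 2. 2 * (16 * real j^2 + 16 * real j + 5)
                 / ((4 * real j + 3)^2 * (4 * real j + 1)^2))
           + 1 / 4 * (ln 2)^2) * pi
        - (1 / 9 + (\<Sum>j=1..(n - 1) div 2. (2 * real j + 1)
                 / ((4 * real j + 3)^2 * (4 * real j + 1)^2))) * 16 * ln 2
        + (1 / 18 + 1 / 6 * (\<Sum>j=1..(n - 1) div 2.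
                 1 / ((4 * real j + 3) * (4 * real j + 1)))) * pi^2
        + 5 * pi^3 / 48 + 2 * catalan_const * ln 2 - 4 * Im (Li3 (1 + \<i>)))
   \<and> (even n \<longrightarrow>
      Theta2_0 n = - 4
        - 8 * (\<Sum>k<n div 2. \<Sum>j=0..2*k + 1.
                 (- 1)^j * (16 * real k^2 + 32 * real k + 17)
                   / ((2 * real j + 1) * (4 * real k + 5)^2 * (4 * real k + 3)^2))
        - 4 * (\<Sum>j<n div 2. 1 / (4 * real j + 5)^3)
        + (1
           + (\<Sum>j<n div 2. 2 * (16 * real j^2 + 32 * real j + 17)
                 / ((4 * real j + 5)^2 * (4 * real j + 3)^2))
           - 1 / 4 * (ln 2)^2) * pi
        + (1 - 16 * (\<Sum>j<n div 2. (real j + 1)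
                 / ((4 * real j + 5)^2 * (4 * real j + 3)^2))) * 2 * ln 2
        + (- (1 / 2) + (\<Sum>j<n div 2.
                 1 / ((4 * real j + 5) * (4 * real j + 3)))) * (pi^2 / 6)
        - 5 * pi^3 / 48 - 2 * catalan_const * ln 2 + 4 * Im (Li3 (1 + \<i>)))"
proof (intro conjI impI)
  show "summable (\<lambda>k. Theta2_0_term n (Suc k))"
    by (simp add: Theta2_0_term_eq summable_moment_term)
next
  assume "n = 0"
  then show "Theta2_0 n = - 4 + pi + 2 * ln 2 - pi / 4 * (ln 2)^2 - pi^2 / 12 - 5 * pi^3 / 48
        - 2 * catalan_const * ln 2 + 4 * Im (Li3 (1 + \<i>))"
    by (simp add: Theta2_0_0 suminf_moment_term_0)
next
  assume "n = 1"
  then show "Theta2_0 n = 116 / 27 - 10 * pi / 9 - 16 * ln 2 / 9 + pi / 4 * (ln 2)^2 + pi^2 / 18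
        + 5 * pi^3 / 48 + 2 * catalan_const * ln 2 - 4 * Im (Li3 (1 + \<i>))"
    \<comment> \<open>At \<open>m = 0\<close> every finite sum is empty.\<close>
    using Theta2_0_odd[of 0] by (simp add: suminf_moment_term_0)
next
  assume "odd n \<and> n \<noteq> 1"
  then obtain m where "n = Suc (2 * m)" by (auto elim: oddE)
  then have n: "n = Suc (2 * m)" "(n - 1) div 2 = m" by simp_all
  show "Theta2_0 n = 116 / 27
        + 8 * (\<Sum>k=1..(n - 1) div 2. \<Sum>j=0..2*k.
                 (- 1)^j * (16 * real k^2 + 16 * real k + 5)
                   / ((2 * real j + 1) * (4 * real k + 3)^2 * (4 * real k + 1)^2))
        - 4 * (\<Sum>j=1..(n - 1) div 2. 1 / (4 * real j + 3)^3)
        + (- (10 / 9)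
           - (\<Sum>j=1..(n - 1) div 2. 2 * (16 * real j^2 + 16 * real j + 5)
                 / ((4 * real j + 3)^2 * (4 * real j + 1)^2))
           + 1 / 4 * (ln 2)^2) * pi
        - (1 / 9 + (\<Sum>j=1..(n - 1) div 2. (2 * real j + 1)
                 / ((4 * real j + 3)^2 * (4 * real j + 1)^2))) * 16 * ln 2
        + (1 / 18 + 1 / 6 * (\<Sum>j=1..(n - 1) div 2.
                 1 / ((4 * real j + 3) * (4 * real j + 1)))) * pi^2
        + 5 * pi^3 / 48 + 2 * catalan_const * ln 2 - 4 * Im (Li3 (1 + \<i>))"
    \<comment> \<open>Once \<open>T 0\<close> is inserted, only its term
      \<open>pi / 4 * (ln 2)\<^sup>2\<close> has to move into the coefficient of
      \<open>pi\<close>.\<close>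
    unfolding n(2) unfolding n(1) Theta2_0_odd suminf_moment_term_0
    by (simp only: algebra_simps)
next
  assume "even n"
  then obtain m where "n = 2 * m" by (auto elim: evenE)
  then have n: "n = 2 * m" "n div 2 = m" by simp_all
  show "Theta2_0 n = - 4
        - 8 * (\<Sum>k<n div 2. \<Sum>j=0..2*k + 1.
                 (- 1)^j * (16 * real k^2 + 32 * real k + 17)
                   / ((2 * real j + 1) * (4 * real k + 5)^2 * (4 * real k + 3)^2))
        - 4 * (\<Sum>j<n div 2. 1 / (4 * real j + 5)^3)
        + (1
           + (\<Sum>j<n div 2. 2 * (16 * real j^2 + 32 * real j + 17)
                 / ((4 * real j + 5)^2 * (4 * real j + 3)^2))
           - 1 / 4 * (ln 2)^2) * pi
        + (1 - 16 * (\<Sum>j<n div 2. (real j + 1)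
                 / ((4 * real j + 5)^2 * (4 * real j + 3)^2))) * 2 * ln 2
        + (- (1 / 2) + (\<Sum>j<n div 2.
                 1 / ((4 * real j + 5) * (4 * real j + 3)))) * (pi^2 / 6)
        - 5 * pi^3 / 48 - 2 * catalan_const * ln 2 + 4 * Im (Li3 (1 + \<i>))"
    unfolding n(2) unfolding n(1) Theta2_0_even suminf_moment_term_0
    by (simp only: algebra_simps)
qed

end
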